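(* Let $G\in\mathcal S(H)$, let $f\in L^1(0,T;\mathcal S(H))$ satisfy $|f(s)|_{\mathcal L(H)}\le c\,(T-s)^{-2\alpha}$ for $s\in[0,T)$, and let $A_0,\widehat C_j\in L^\infty(0,T;\mathcal L(H))$ ($j\ge 1$) satisfy $$|A_0(s)|_{\mathcal L(H)}\le c\,(T-s)^{-\alpha},\quad s\in[0,T),$$ $$\sum_{j=1}^\infty |e^{At}\widehat C_j(s)x|_H^2\le c\left(t^{-2\alpha}+(T-s)^{-2\alpha}\right)|x|_H^2,\quad (t,s)\in(0,\infty)\times[0,T),\ x\in H.$$ Then there exists a unique mild solution $P\in C_s([0,T];\mathcal S(H))$ of the Lyapunov equation $$P_t'+A^*P_t+P_tA+A_0^*(t)P_t+P_tA_0(t)+\sum_{i=1}^\infty \widehat C_i^*(t)P_t\widehat C_i(t)+f_t=0,\ t\in[0,T);\qquad P_T=G,$$ such that, for some constant $C>0$, $$\sum_{i=1}^\infty\left|\langle \widehat C_i(s)^*P_s\widehat C_i(s)x,x\rangle\right|\le C(T-s)^{-2\alpha}|x|^2,\qquad s\in[0,T),\ x\in H.$$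
   Context: $H$ is a (real) separable Hilbert space; $\mathcal L(H)$ is the space of bounded linear operators on $H$; $\mathcal S(H)$ is the space of self-adjoint bounded operators. $C_s([0,T];\mathcal S(H))$ is the set of maps $[0,T]\to\mathcal S(H)$ that are strongly continuous ($t\mapsto P_tx$ continuous for each $x\in H$). $T>0$, $c>0$ and $\alpha\in(0,\tfrac12)$ are fixed; $A$ is the infinitesimal generator of a strongly continuous semigroup $e^{tA}$ on $H$. A mild solution of the Lyapunov equation is a $P$ with, for all $t\in[0,T]$, $$P_t=e^{A^*(T-t)}Ge^{A(T-t)}+\int_t^T e^{A^*(s-t)}f_se^{A(s-t)}ds+\int_t^T e^{A^*(s-t)}\Big[A_0^*(s)P_s+P_sA_0(s)+\sum_{i=1}^\infty \widehat C_i^*(s)P_s\widehat C_i(s)\Big]e^{A(s-t)}ds,$$ where the operator $\sum_i\widehat C_i^*(s)P_s\widehat C_i(s)$ is defined through its (absolutely convergent) quadratic form and the integrals are understood in the weak/strong operator sense. Uniqueness is among mild solutions in $C_s([0,T];\mathcal S(H))$ satisfying an estimate of the displayed form (for some constant). *)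

theory Defs
  imports "HOL-Analysis.Analysis"
begin

section \<open>Strongly continuous semigroups\<close>

definition c0_semigroup :: "(real \<Rightarrow> 'a::banach \<Rightarrow>\<^sub>L 'a) \<Rightarrow> bool" where
  "c0_semigroup S \<longleftrightarrow>
     S 0 = id_blinfun \<and>
     (\<forall>s\<ge>0. \<forall>t\<ge>0. S (s + t) = S s o\<^sub>L S t) \<and>
     (\<forall>x. continuous_on {0..} (\<lambda>t. S t x))"

text \<open>The unbounded operator \<open>A\<close> is represented by its domain \<open>D\<close> and a function \<open>A\<close> whose
  values outside \<open>D\<close> are irrelevant; \<open>S t\<close> plays the role of \<open>exp (t A)\<close>.\<close>

definition infinitesimal_generator ::
    "'a set \<Rightarrow> ('a \<Rightarrow> 'a) \<Rightarrow> (real \<Rightarrow> 'a::banach \<Rightarrow>\<^sub>L 'a) \<Rightarrow> bool" where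
  "infinitesimal_generator D A S \<longleftrightarrow>
     c0_semigroup S \<and>
     D = {x. \<exists>y. ((\<lambda>h. (S h x - x) /\<^sub>R h) \<longlongrightarrow> y) (at_right 0)} \<and>
     (\<forall>x\<in>D. ((\<lambda>h. (S h x - x) /\<^sub>R h) \<longlongrightarrow> A x) (at_right 0))"


section \<open>Operators on a Hilbert space\<close>

text \<open>Hilbert space adjoint; the library's \<^const>\<open>adjoint\<close> acts on bare functions. On a complete
  space it exists, and is bounded, for every bounded operator by the Riesz representation
  theorem.\<close>

definition adj :: "('h::{real_inner,banach} \<Rightarrow>\<^sub>L 'h) \<Rightarrow> 'h \<Rightarrow>\<^sub>L 'h" where
  "adj B = Blinfun (adjoint (blinfun_apply B))"

definition self_adjoint :: "('h::real_inner \<Rightarrow>\<^sub>L 'h) \<Rightarrow> bool" where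
  "self_adjoint B \<longleftrightarrow> (\<forall>x y. B x \<bullet> y = x \<bullet> B y)"

definition Cs_self_adjoint :: "real \<Rightarrow> (real \<Rightarrow> 'h::real_inner \<Rightarrow>\<^sub>L 'h) set" where
  "Cs_self_adjoint T = {P. (\<forall>t\<in>{0..T}. self_adjoint (P t)) \<and>
                           (\<forall>x. continuous_on {0..T} (\<lambda>t. P t x))}"


section \<open>Bochner--Lebesgue spaces over \<open>(0,T)\<close> with values in a Banach space\<close>

text \<open>The library's \<^const>\<open>integrable\<close> requires a second countable target, which the space of
  bounded operators is not; hence the classical definition through simple functions.\<close>

definition bochner_measurable :: "real \<Rightarrow> (real \<Rightarrow> 'b::real_normed_vector) \<Rightarrow> bool" where
  "bochner_measurable T f \<longleftrightarrow>
     (\<exists>F :: nat \<Rightarrow> real \<Rightarrow> 'b.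
        (\<forall>n. simple_function (lebesgue_on {0<..<T}) (F n)) \<and>
        (AE s in lebesgue_on {0<..<T}. (\<lambda>n. F n s) \<longlonglongrightarrow> f s))"

definition bochner_L1 :: "real \<Rightarrow> (real \<Rightarrow> 'b::real_normed_vector) set" where
  "bochner_L1 T = {f. bochner_measurable T f \<and>
                      integrable (lebesgue_on {0<..<T}) (\<lambda>s. norm (f s))}"

definition bochner_Linf :: "real \<Rightarrow> (real \<Rightarrow> 'b::real_normed_vector) set" where
  "bochner_Linf T = {f. bochner_measurable T f \<and>
                        (\<exists>K. AE s in lebesgue_on {0<..<T}. norm (f s) \<le> K)}"


section \<open>The Lyapunov equation\<close>

text \<open>The sequence \<open>C\<^sub>1, C\<^sub>2, \<dots>\<close> is indexed from \<open>0\<close>, and \<open>C i s\<close> is the value of its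
  \<open>i\<close>-th member at time \<open>s\<close>.\<close>

text \<open>The operator \<open>\<Sum>i. C\<^sub>i\<^sup>* Q C\<^sub>i\<close>: the self-adjoint bounded operator whose quadratic
  form is the sum of the series of the quadratic forms. The series need not converge in
  operator norm. Polarization gives uniqueness; existence holds whenever \<open>Q\<close> is self-adjoint and
  the series of quadratic forms converges absolutely at every \<open>x\<close>.\<close>

definition sandwich_sum ::
    "(nat \<Rightarrow> 'h::{real_inner,banach} \<Rightarrow>\<^sub>L 'h) \<Rightarrow> ('h \<Rightarrow>\<^sub>L 'h) \<Rightarrow> 'h \<Rightarrow>\<^sub>L 'h" where
  "sandwich_sum C Q =
     (THE K. self_adjoint K \<and>
             (\<forall>x. (\<lambda>i. (adj (C i) o\<^sub>L Q o\<^sub>L C i) x \<bullet> x) sums (K x \<bullet> x)))"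

definition lyap_term ::
    "(real \<Rightarrow> 'h \<Rightarrow>\<^sub>L 'h) \<Rightarrow> (nat \<Rightarrow> real \<Rightarrow> 'h \<Rightarrow>\<^sub>L 'h) \<Rightarrow> (real \<Rightarrow> 'h \<Rightarrow>\<^sub>L 'h)
      \<Rightarrow> real \<Rightarrow> 'h::{real_inner,banach} \<Rightarrow>\<^sub>L 'h" where
  "lyap_term A0 C P s =
     (adj (A0 s) o\<^sub>L P s) + (P s o\<^sub>L A0 s) + sandwich_sum (\<lambda>i. C i s) (P s)"

text \<open>Mild solutions in \<open>C\<^sub>s([0,T]; S(H))\<close>. The operator integrals are taken in the strong sense,
  i.e. as \<open>H\<close>-valued Bochner integrals after evaluation at \<open>x\<close>; since the integral and
  \<^const>\<open>sandwich_sum\<close> are total, integrability and absolute convergence are demanded explicitly.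
  The completed Lebesgue measure is used because the coefficients are only Lebesgue measurable.\<close>

definition mild_solution ::
    "real \<Rightarrow> (real \<Rightarrow> 'h::{real_inner,banach,second_countable_topology} \<Rightarrow>\<^sub>L 'h)
      \<Rightarrow> (real \<Rightarrow> 'h \<Rightarrow>\<^sub>L 'h) \<Rightarrow> (nat \<Rightarrow> real \<Rightarrow> 'h \<Rightarrow>\<^sub>L 'h)
      \<Rightarrow> (real \<Rightarrow> 'h \<Rightarrow>\<^sub>L 'h) \<Rightarrow> ('h \<Rightarrow>\<^sub>L 'h) \<Rightarrow> (real \<Rightarrow> 'h \<Rightarrow>\<^sub>L 'h) \<Rightarrow> bool" where
  "mild_solution T S A0 C f G P \<longleftrightarrow>
     P \<in> Cs_self_adjoint T \<and>
     (\<forall>s\<in>{0..<T}. \<forall>x. summable (\<lambda>i. \<bar>(adj (C i s) o\<^sub>L P s o\<^sub>L C i s) x \<bullet> x\<bar>)) \<and>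
     (\<forall>t\<in>{0..T}. \<forall>x.
        integrable (lebesgue_on {t..T})
          (\<lambda>s. (adj (S (s - t)) o\<^sub>L f s o\<^sub>L S (s - t)) x) \<and>
        integrable (lebesgue_on {t..T})
          (\<lambda>s. (adj (S (s - t)) o\<^sub>L lyap_term A0 C P s o\<^sub>L S (s - t)) x) \<and>
        P t x =
          (adj (S (T - t)) o\<^sub>L G o\<^sub>L S (T - t)) x
          + (\<integral>s. (adj (S (s - t)) o\<^sub>L f s o\<^sub>L S (s - t)) x \<partial>lebesgue_on {t..T})
          + (\<integral>s. (adj (S (s - t)) o\<^sub>L lyap_term A0 C P s o\<^sub>L S (s - t)) x
               \<partial>lebesgue_on {t..T}))"

definition sandwich_estimate ::
    "real \<Rightarrow> real \<Rightarrow> (nat \<Rightarrow> real \<Rightarrow> 'h::{real_inner,banach} \<Rightarrow>\<^sub>L 'h)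
      \<Rightarrow> (real \<Rightarrow> 'h \<Rightarrow>\<^sub>L 'h) \<Rightarrow> real \<Rightarrow> bool" where
  "sandwich_estimate T \<alpha> C P K \<longleftrightarrow>
     (\<forall>s\<in>{0..<T}. \<forall>x.
        summable (\<lambda>i. \<bar>(adj (C i s) o\<^sub>L P s o\<^sub>L C i s) x \<bullet> x\<bar>) \<and>
        (\<Sum>i. \<bar>(adj (C i s) o\<^sub>L P s o\<^sub>L C i s) x \<bullet> x\<bar>)
          \<le> K * (T - s) powr (- 2 * \<alpha>) * (norm x)\<^sup>2)"

end

theory Submission
  imports Defs
begin

text \<open>The unknown is the whole bracket \<open>L s = A\<^sub>0\<^sup>* P + P A\<^sub>0 + \<Sum>i. C\<^sub>i\<^sup>* P C\<^sub>i\<close> at time \<open>s\<close>. Given \<open>L\<close>,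
  the mild equation determines \<open>P\<close>, and the smoothing hypothesis on \<open>e\<^sup>t\<^sup>A C\<^sub>i\<close>, applied under the
  integral that represents \<open>P\<close>, bounds the quadratic forms \<open>\<Sum>i. \<bar>\<langle>P C\<^sub>i x, C\<^sub>i x\<rangle>\<bar>\<close> although the \<open>C\<^sub>i\<close> are not
  square summable themselves. The resulting map on \<open>L\<close> is affine, and a contraction for the norm
  \<open>sup\<^sub>s \<bar>L s\<bar> (T - s)\<^sup>2\<^sup>\<alpha> exp (- \<beta> (T - s))\<close> with \<open>\<beta>\<close> large: the exponents \<open>2 \<alpha>\<close> of the two
  singularities at \<open>r = s\<close> and \<open>r = T\<close> are integrable and cost just one factor
  \<open>(T - s)\<^sup>-\<^sup>2\<^sup>\<alpha>\<close>. The fixed point is the solution, and the difference of two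
  solutions, whose brackets lie in the weighted space by uniform boundedness, is \<open>0\<close>.\<close>

section \<open>Hilbert spaces and adjoints\<close>

text \<open>The iteration does not close on P alone: continuity and self-adjointness of P give no
  bound on the forms <P C_i x, C_i x>, whereas in \<open>evolve L t\<close> a semigroup factor
  stands next to each C_i. Every estimate is made on quadratic forms, which control the norm of a
  self-adjoint operator without loss of constant.

  Two obstacles shape the preparations. The space of operators is not separable and the infinite sum
  is given only by its quadratic form, so measurability is kept in the form s |-> L s x and derived
  from weak measurability. Strong continuity of P and measurability of the integrands involve the
  adjoint semigroup, whose strong continuity has to be proved and rests on orthogonal projection.

  No weighted Banach space is built: a bound by \<open>m * weight \<beta> s\<close> replaces
  "weighted norm at most m", and limits are taken at each s separately. Of the room 1 - 2\<alpha>
  left below the critical exponent 1, one half, \<epsilon>, is spent on the small factor; the other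
  half keeps \<gamma> = 2\<alpha> + \<epsilon> integrable.\<close>

lemma closed_subspace_decomp:
  fixes V :: "'h::{real_inner,banach} set"
  assumes V: "subspace V" "closed V"
  shows "\<exists>p\<in>V. \<forall>v\<in>V. (x - p) \<bullet> v = 0"
proof -
  define d where "d = (INF v\<in>V. (norm (x - v))\<^sup>2)"
  have ne: "V \<noteq> {}" using V(1) subspace_0 by auto
  have bdd: "bdd_below ((\<lambda>v. (norm (x - v))\<^sup>2) ` V)" by (rule bdd_belowI2[of _ 0]) auto
  have dle: "d \<le> (norm (x - v))\<^sup>2" if "v \<in> V" for v
    unfolding d_def by (rule cINF_lower[OF bdd that])
  have "\<exists>v\<in>V. (norm (x - v))\<^sup>2 < d + inverse (real (Suc n))" for n
    using cINF_less_iff[OF ne bdd, of "d + inverse (real (Suc n))"] by (simp add: d_def)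
  then obtain v where vV: "\<And>n. v n \<in> V"
    and vd: "\<And>n. (norm (x - v n))\<^sup>2 < d + inverse (real (Suc n))" by metis
  \<comment> \<open>Parallelogram law: the midpoint of a and b lies in V, so its squared distance to
    x is at least d. This makes a minimizing sequence Cauchy.\<close>
  have par: "(norm (a - b))\<^sup>2 \<le> 2 * ((norm (x - a))\<^sup>2 - d) + 2 * ((norm (x - b))\<^sup>2 - d)"
    if "a \<in> V" "b \<in> V" for a b
  proof -
    have "(1/2) *\<^sub>R (a + b) \<in> V" using V(1) that by (simp add: subspace_add subspace_scale)
    from dle[OF this] have "d \<le> (norm (x - (1/2) *\<^sub>R (a + b)))\<^sup>2" .
    moreover have "4 * (norm (x - (1/2) *\<^sub>R (a + b)))\<^sup>2 + (norm (a - b))\<^sup>2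
        = 2 * (norm (x - a))\<^sup>2 + 2 * (norm (x - b))\<^sup>2"
      unfolding power2_norm_eq_inner
      by (simp add: inner_diff_left inner_diff_right inner_add_left inner_add_right
          inner_commute field_simps)
    ultimately show ?thesis by simp
  qed
  have aux: "X < E" if "X \<le> 2 * (a - d) + 2 * (b - d)" "a < d + \<epsilon>" "b < d + \<epsilon>" "\<epsilon> < E / 4"
    for X E a b \<epsilon> :: real using that by (simp add: field_simps)
  have "Cauchy v"
  proof (rule metric_CauchyI)
    fix e :: real assume "e > 0"
    then obtain N where N: "inverse (real (Suc N)) < e\<^sup>2 / 4"
      using reals_Archimedean[of "e\<^sup>2 / 4"] by auto
    show "\<exists>M. \<forall>m\<ge>M. \<forall>n\<ge>M. dist (v m) (v n) < e"
    proof (intro exI allI impI)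
      fix m n assume mn: "m \<ge> N" "n \<ge> N"
      have i: "inverse (real (Suc k)) \<le> inverse (real (Suc N))" if "k \<ge> N" for k
        using that by (intro le_imp_inverse_le) auto
      define \<epsilon> where "\<epsilon> = inverse (real (Suc N))"
      have "(norm (x - v m))\<^sup>2 < d + \<epsilon>" "(norm (x - v n))\<^sup>2 < d + \<epsilon>" "\<epsilon> < e\<^sup>2 / 4"
        using less_le_trans[OF vd[of m] add_left_mono[OF i[OF mn(1)]]]
          less_le_trans[OF vd[of n] add_left_mono[OF i[OF mn(2)]]] N
        unfolding \<epsilon>_def by blast+
      then have "(norm (v m - v n))\<^sup>2 < e\<^sup>2"
        by (rule aux[OF par[OF vV vV]])
      then show "dist (v m) (v n) < e"
        using \<open>e > 0\<close> by (simp add: dist_norm power_less_imp_less_base)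
    qed
  qed
  then obtain p where p: "v \<longlonglongrightarrow> p" using Cauchy_convergent_iff convergent_def by blast
  have pV: "p \<in> V" using closed_sequentially[OF V(2)] vV p by blast
  have "(\<lambda>n. (norm (x - v n))\<^sup>2) \<longlonglongrightarrow> (norm (x - p))\<^sup>2" by (intro tendsto_intros p)
  moreover have "(\<lambda>n. d + inverse (real (Suc n))) \<longlonglongrightarrow> d + 0"
    by (intro tendsto_intros LIMSEQ_inverse_real_of_nat)
  ultimately have pd: "(norm (x - p))\<^sup>2 \<le> d"
    using vd by (intro tendsto_le[of sequentially "\<lambda>n. d + inverse (real (Suc n))" d "\<lambda>n. (norm (x - v n))\<^sup>2"])
      (auto intro!: always_eventually less_imp_le)
  have "(x - p) \<bullet> w = 0" if w: "w \<in> V" for w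
  proof (cases "w = 0")
    case False
    \<comment> \<open>The t that minimizes the norm of (x - p) - t w; minimality of p then forces
      the component of x - p along w to vanish.\<close>
    define t where "t = ((x - p) \<bullet> w) / (w \<bullet> w)"
    have ww: "w \<bullet> w > 0" using False by simp
    have "p + t *\<^sub>R w \<in> V" using V(1) pV w by (simp add: subspace_add subspace_scale)
    from order_trans[OF pd dle[OF this]]
    have "(norm (x - p))\<^sup>2 \<le> (norm ((x - p) - t *\<^sub>R w))\<^sup>2"
      unfolding diff_diff_add .
    also have "\<dots> = (norm (x - p))\<^sup>2 - 2 * t * ((x - p) \<bullet> w) + t\<^sup>2 * (w \<bullet> w)"
      unfolding power2_norm_eq_inner
      by (simp add: inner_diff_left inner_diff_right inner_commute power2_eq_square algebra_simps)
    also have "\<dots> = (norm (x - p))\<^sup>2 - ((x - p) \<bullet> w)\<^sup>2 / (w \<bullet> w)"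
      using ww by (simp add: t_def power2_eq_square field_simps)
    finally have "((x - p) \<bullet> w)\<^sup>2 \<le> 0" using ww by (simp add: field_simps)
    then show ?thesis by simp
  qed simp
  with pV show ?thesis by blast
qed

text \<open>The kernel of \<phi> is a closed hyperplane, and its normal vector q = u - p represents
  \<phi> up to the scalar \<phi> q / (q . q).\<close>

lemma riesz_representation:
  fixes \<phi> :: "'h::{real_inner,banach} \<Rightarrow> real"
  assumes "bounded_linear \<phi>"
  shows "\<exists>z. \<forall>y. \<phi> y = z \<bullet> y"
proof (cases "\<forall>y. \<phi> y = 0")
  case False
  interpret \<phi>: bounded_linear \<phi> by fact
  define V where "V = {v. \<phi> v = 0}"
  have "subspace V" by (auto simp: V_def subspace_def \<phi>.zero \<phi>.add \<phi>.scaleR)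
  moreover have "closed V"
    unfolding V_def by (intro closed_Collect_eq continuous_intros \<phi>.continuous_on)
  moreover obtain u where u: "\<phi> u \<noteq> 0" using False by blast
  ultimately obtain p where pV: "p \<in> V" and p: "\<And>v. v \<in> V \<Longrightarrow> (u - p) \<bullet> v = 0"
    using closed_subspace_decomp by blast
  define q where "q = u - p"
  have \<phi>q: "\<phi> q \<noteq> 0" using u pV by (simp add: q_def V_def \<phi>.diff)
  then have qq: "q \<bullet> q \<noteq> 0" using \<phi>.zero by auto
  have "\<phi> y = ((\<phi> q / (q \<bullet> q)) *\<^sub>R q) \<bullet> y" for y
  proof -
    have "y - (\<phi> y / \<phi> q) *\<^sub>R q \<in> V" using \<phi>q by (simp add: V_def \<phi>.diff \<phi>.scaleR)
    from p[OF this] have "q \<bullet> y = (\<phi> y / \<phi> q) * (q \<bullet> q)"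
      by (simp add: q_def[symmetric] inner_diff_right)
    then show ?thesis using \<phi>q qq by (simp add: field_simps)
  qed
  then show ?thesis by blast
qed (auto intro: exI[of _ 0])

lemma norm_le_if_inner_le:
  fixes z :: "'h::real_inner"
  assumes "\<And>y. z \<bullet> y \<le> k * norm y" and "0 \<le> k"
  shows "norm z \<le> k"
proof (cases "z = 0")
  case False
  then show ?thesis using assms(1)[of z] by (simp add: dot_square_norm power2_eq_square)
qed (use assms in simp)

text \<open>Riesz in the second argument yields \<open>K x\<close>; linearity in x follows because a
  vector is determined by its inner products. Serves both adjoints and sums of conjugates.\<close>

lemma bounded_form_representation:
  fixes b :: "'h::{real_inner,banach} \<Rightarrow> 'h \<Rightarrow> real"
  assumes lin1: "\<And>y. linear (\<lambda>x. b x y)" and lin2: "\<And>x. linear (b x)"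
    and bnd: "\<And>x y. \<bar>b x y\<bar> \<le> k * norm x * norm y" and k: "0 \<le> k"
  shows "\<exists>K :: 'h \<Rightarrow>\<^sub>L 'h. \<forall>x y. K x \<bullet> y = b x y"
proof -
  have "\<exists>z. \<forall>y. b x y = z \<bullet> y" for x
  proof (rule riesz_representation)
    show "bounded_linear (b x)"
    proof (rule bounded_linear_intro[where K = "k * norm x"])
      show "norm (b x y) \<le> norm y * (k * norm x)" for y
        using bnd[of x y] by (simp add: mult_ac)
    qed (use lin2[of x] in \<open>auto simp: linear_iff\<close>)
  qed
  then obtain K where K: "\<And>x y. b x y = K x \<bullet> y" by metis
  have "bounded_linear K"
  proof (rule bounded_linear_intro[where K = k])
    fix x y :: 'h and r :: real
    have "K (x + y) \<bullet> z = (K x + K y) \<bullet> z" for z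
      using lin1[of z] by (simp add: inner_add_left K[symmetric] linear_iff)
    then show "K (x + y) = K x + K y" by (metis vector_eq_rdot)
    have "K (r *\<^sub>R x) \<bullet> z = (r *\<^sub>R K x) \<bullet> z" for z
      using lin1[of z] by (simp add: K[symmetric] linear_iff)
    then show "K (r *\<^sub>R x) = r *\<^sub>R K x" by (metis vector_eq_rdot)
    show "norm (K x) \<le> norm x * k"
      by (rule norm_le_if_inner_le) (use bnd[of x] k in \<open>simp_all add: K[symmetric] abs_le_iff mult_ac\<close>)
  qed
  then show ?thesis using K by (metis bounded_linear_Blinfun_apply)
qed

text \<open>\<open>adj\<close> wraps a choice-based adjoint in \<open>Blinfun\<close>, so it means
  something only once a bounded operator with the adjoint identity exists. The form x . B y supplies
  one, and uniqueness identifies it.\<close>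

lemma adj_inner:
  fixes B :: "'h::{real_inner,banach} \<Rightarrow>\<^sub>L 'h"
  shows "adj B x \<bullet> y = x \<bullet> B y"
proof -
  obtain K :: "'h \<Rightarrow>\<^sub>L 'h" where K: "\<And>x y. K x \<bullet> y = x \<bullet> B y"
  proof -
    have "\<exists>K :: 'h \<Rightarrow>\<^sub>L 'h. \<forall>x y. K x \<bullet> y = x \<bullet> B y"
    proof (rule bounded_form_representation[where k = "norm B"])
      fix x y
      have "\<bar>x \<bullet> B y\<bar> \<le> norm x * norm (B y)" by (rule Cauchy_Schwarz_ineq2)
      also have "\<dots> \<le> norm x * (norm B * norm y)" by (intro mult_left_mono norm_blinfun) auto
      finally show "\<bar>x \<bullet> B y\<bar> \<le> norm B * norm x * norm y" by (simp add: mult_ac)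
    qed (auto simp: linear_iff inner_add_left inner_add_right blinfun.add_right blinfun.scaleR_right)
    then show ?thesis using that by blast
  qed
  have "adjoint (blinfun_apply B) = blinfun_apply K"
    by (rule adjoint_unique) (metis K inner_commute)
  then show ?thesis by (simp add: adj_def blinfun_apply_inverse K)
qed

lemma adj_inner': "x \<bullet> adj B y = B x \<bullet> y"
  for B :: "'h::{real_inner,banach} \<Rightarrow>\<^sub>L 'h"
  by (metis adj_inner inner_commute)

lemma norm_adj_le: "norm (adj B) \<le> norm B"
  for B :: "'h::{real_inner,banach} \<Rightarrow>\<^sub>L 'h"
proof (rule norm_blinfun_bound)
  fix x
  show "norm (adj B x) \<le> norm B * norm x"
  proof (rule norm_le_if_inner_le)
    fix y
    have "adj B x \<bullet> y \<le> norm x * norm (B y)"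
      unfolding adj_inner by (rule norm_cauchy_schwarz)
    also have "\<dots> \<le> norm x * (norm B * norm y)" by (intro mult_left_mono norm_blinfun) auto
    finally show "adj B x \<bullet> y \<le> norm B * norm x * norm y" by (simp add: mult_ac)
  qed simp
qed simp

lemma adj_eqI:
  fixes B K :: "'h::{real_inner,banach} \<Rightarrow>\<^sub>L 'h"
  assumes "\<And>x y. K x \<bullet> y = x \<bullet> B y"
  shows "adj B = K"
  by (rule blinfun_eqI, rule vector_eq_rdot[THEN iffD1]) (simp add: adj_inner assms)

lemma adj_compose: "adj (B o\<^sub>L B') = adj B' o\<^sub>L adj B"
  for B B' :: "'h::{real_inner,banach} \<Rightarrow>\<^sub>L 'h"
  by (rule adj_eqI) (simp add: adj_inner)

lemma adj_diff: "adj (B - B') = adj B - adj B'"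
  for B B' :: "'h::{real_inner,banach} \<Rightarrow>\<^sub>L 'h"
  by (rule adj_eqI) (simp add: adj_inner blinfun.diff_left inner_diff_left inner_diff_right)

lemma polarization:
  fixes Q :: "'h::real_inner \<Rightarrow>\<^sub>L 'h"
  assumes "self_adjoint Q"
  shows "Q x \<bullet> y = (Q (x + y) \<bullet> (x + y) - Q (x - y) \<bullet> (x - y)) / 4"
proof -
  have "Q y \<bullet> x = Q x \<bullet> y" using assms by (metis self_adjoint_def inner_commute)
  then show ?thesis
    by (simp add: blinfun.add_right blinfun.diff_right inner_add_left inner_add_right
        inner_diff_left inner_diff_right)
qed

text \<open>Polarization and the parallelogram law give k (|x|^2 + |y|^2) / 2; normalizing x and y
  first turns this into the product bound with the same k.\<close>

lemma form_bound_of_quadratic_bound: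
  fixes b :: "'h::real_inner \<Rightarrow> 'h \<Rightarrow> real"
  assumes pol: "\<And>x y. b x y = (q (x + y) - q (x - y)) / 4"
    and q: "\<And>x. \<bar>q x\<bar> \<le> k * (norm x)\<^sup>2"
    and lin1: "\<And>y. linear (\<lambda>x. b x y)" and lin2: "\<And>x. linear (b x)"
  shows "\<bar>b x y\<bar> \<le> k * norm x * norm y"
proof (cases "x = 0 \<or> y = 0")
  case True
  then show ?thesis using linear_0[OF lin1[of y]] linear_0[OF lin2[of x]] by auto
next
  case False
  have 1: "\<bar>b u v\<bar> \<le> k" if "norm u = 1" "norm v = 1" for u v
  proof -
    have "\<bar>b u v\<bar> \<le> (\<bar>q (u + v)\<bar> + \<bar>q (u - v)\<bar>) / 4" by (simp add: pol)
    also have "\<dots> \<le> k * ((norm (u + v))\<^sup>2 + (norm (u - v))\<^sup>2) / 4"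
      using q[of "u + v"] q[of "u - v"] by (simp add: distrib_left)
    also have "(norm (u + v))\<^sup>2 + (norm (u - v))\<^sup>2 = 2 * (norm u)\<^sup>2 + 2 * (norm v)\<^sup>2"
      unfolding power2_norm_eq_inner
      by (simp add: inner_add_left inner_add_right inner_diff_left inner_diff_right)
    finally show ?thesis using that by simp
  qed
  define u v where "u = x /\<^sub>R norm x" and "v = y /\<^sub>R norm y"
  have "x = norm x *\<^sub>R u" "y = norm y *\<^sub>R v" using False by (auto simp: u_def v_def)
  then have "b x y = norm x * (norm y * b u v)"
    using linear_scale[OF lin1] linear_scale[OF lin2] by (metis real_scaleR_def)
  then have "\<bar>b x y\<bar> = norm x * (norm y * \<bar>b u v\<bar>)" by (simp add: abs_mult)
  also have "\<dots> \<le> norm x * (norm y * k)"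
    using False by (intro mult_left_mono 1) (auto simp: u_def v_def)
  finally show ?thesis by (simp add: mult_ac)
qed

lemma self_adjoint_norm_le:
  fixes Q :: "'h::real_inner \<Rightarrow>\<^sub>L 'h"
  assumes Q: "self_adjoint Q" and q: "\<And>x. \<bar>Q x \<bullet> x\<bar> \<le> k * (norm x)\<^sup>2" and k: "0 \<le> k"
  shows "norm Q \<le> k"
proof (rule norm_blinfun_bound[OF k], rule norm_le_if_inner_le)
  fix x y
  have "\<bar>Q x \<bullet> y\<bar> \<le> k * norm x * norm y"
    by (rule form_bound_of_quadratic_bound[where q = "\<lambda>x. Q x \<bullet> x"])
      (rule polarization[OF Q] q, simp_all add: q linear_iff blinfun.add_right
        blinfun.scaleR_right inner_add_left inner_add_right)
  then show "Q x \<bullet> y \<le> k * norm x * norm y" by simp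
qed (use k in simp)

lemma self_adjoint_add: "self_adjoint P \<Longrightarrow> self_adjoint Q \<Longrightarrow> self_adjoint (P + Q)"
  by (simp add: self_adjoint_def blinfun.add_left inner_add_left inner_add_right)

lemma self_adjoint_diff: "self_adjoint P \<Longrightarrow> self_adjoint Q \<Longrightarrow> self_adjoint (P - Q)"
  by (simp add: self_adjoint_def blinfun.diff_left inner_diff_left inner_diff_right)

lemma self_adjoint_conjugate:
  fixes Q B :: "'h::{real_inner,banach} \<Rightarrow>\<^sub>L 'h"
  assumes "self_adjoint Q"
  shows "self_adjoint (adj B o\<^sub>L Q o\<^sub>L B)"
  using assms by (simp add: self_adjoint_def adj_inner adj_inner')

lemma self_adjoint_eqI:
  fixes P Q :: "'h::real_inner \<Rightarrow>\<^sub>L 'h"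
  assumes "self_adjoint P" "self_adjoint Q" "\<And>x. P x \<bullet> x = Q x \<bullet> x"
  shows "P = Q"
proof -
  have "norm (P - Q) \<le> 0"
    by (rule self_adjoint_norm_le) (use assms in \<open>auto simp: self_adjoint_diff blinfun.diff_left inner_diff_left\<close>)
  then show ?thesis by simp
qed

lemma abs_inner_blinfun_le:
  fixes Q :: "'h::real_inner \<Rightarrow>\<^sub>L 'h"
  shows "\<bar>Q x \<bullet> y\<bar> \<le> norm Q * norm x * norm y"
proof -
  have "\<bar>Q x \<bullet> y\<bar> \<le> norm (Q x) * norm y" by (rule Cauchy_Schwarz_ineq2)
  also have "\<dots> \<le> (norm Q * norm x) * norm y" by (intro mult_right_mono norm_blinfun) auto
  finally show ?thesis .
qed

lemma abs_quadratic_le: "\<bar>Q x \<bullet> x\<bar> \<le> norm Q * (norm x)\<^sup>2"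
  for Q :: "'h::real_inner \<Rightarrow>\<^sub>L 'h"
  using abs_inner_blinfun_le[of Q x x] by (simp add: power2_eq_square mult_ac)

section \<open>Sums of conjugates\<close>

text \<open>Each conjugate is self-adjoint, so polarization carries convergence from the quadratic
  to the bilinear forms. Their sum is a bounded form, represented by an operator K; no convergence
  in operator norm is involved. The description in \<open>sandwich_sum\<close> picks K because a
  self-adjoint operator is determined by its quadratic form.\<close>

lemma
  fixes C :: "nat \<Rightarrow> 'h::{real_inner,banach} \<Rightarrow>\<^sub>L 'h"
  assumes Q: "self_adjoint Q"
    and sm: "\<And>x. summable (\<lambda>i. \<bar>(adj (C i) o\<^sub>L Q o\<^sub>L C i) x \<bullet> x\<bar>)"
    and bd: "\<And>x. (\<Sum>i. \<bar>(adj (C i) o\<^sub>L Q o\<^sub>L C i) x \<bullet> x\<bar>) \<le> k * (norm x)\<^sup>2"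
    and k: "0 \<le> k"
  shows self_adjoint_sandwich_sum: "self_adjoint (sandwich_sum C Q)"
    and sums_sandwich_sum:
      "(\<lambda>i. (adj (C i) o\<^sub>L Q o\<^sub>L C i) x \<bullet> x) sums (sandwich_sum C Q x \<bullet> x)"
    and norm_sandwich_sum_le: "norm (sandwich_sum C Q) \<le> k"
proof -
  define R where "R = (\<lambda>i. adj (C i) o\<^sub>L Q o\<^sub>L C i)"
  have R: "self_adjoint (R i)" for i unfolding R_def by (rule self_adjoint_conjugate[OF Q])
  have smR: "summable (\<lambda>i. R i x \<bullet> x)" for x
    using sm[of x] unfolding R_def by (rule summable_rabs_cancel)
  define b where "b = (\<lambda>x y. \<Sum>i. R i x \<bullet> y)"
  have smb: "summable (\<lambda>i. R i x \<bullet> y)" for x y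
    by (subst polarization[OF R]) (intro summable_divide summable_diff smR)
  have pol: "b x y = ((\<Sum>i. R i (x + y) \<bullet> (x + y)) - (\<Sum>i. R i (x - y) \<bullet> (x - y))) / 4" for x y
  proof -
    have "b x y = (\<Sum>i. (R i (x + y) \<bullet> (x + y) - R i (x - y) \<bullet> (x - y)) / 4)"
      unfolding b_def by (rule suminf_cong) (rule polarization[OF R])
    also have "\<dots> = (\<Sum>i. R i (x + y) \<bullet> (x + y) - R i (x - y) \<bullet> (x - y)) / 4"
      by (rule suminf_divide[OF summable_diff[OF smR smR]])
    finally show ?thesis by (simp only: suminf_diff[OF smR smR])
  qed
  have bq: "\<bar>\<Sum>i. R i x \<bullet> x\<bar> \<le> k * (norm x)\<^sup>2" for x
    using summable_rabs[OF sm[of x]] bd[of x] unfolding R_def by linarith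
  have lin1: "linear (\<lambda>x. b x y)" for y
    by (auto simp: linear_iff b_def blinfun.add_right blinfun.scaleR_right inner_add_left
        suminf_add[OF smb smb] suminf_mult[OF smb])
  have lin2: "linear (b x)" for x
    by (auto simp: linear_iff b_def inner_add_right suminf_add[OF smb smb] suminf_mult[OF smb])
  have "\<bar>b x y\<bar> \<le> k * norm x * norm y" for x y
    by (rule form_bound_of_quadratic_bound[OF pol bq lin1 lin2])
  then obtain K :: "'h \<Rightarrow>\<^sub>L 'h" where K: "\<And>x y. K x \<bullet> y = b x y"
    using bounded_form_representation[OF lin1 lin2 _ k] by metis
  have "b x y = b y x" for x y
    unfolding b_def using R by (metis (no_types, lifting) self_adjoint_def inner_commute)
  then have Ks: "self_adjoint K" by (metis K self_adjoint_def inner_commute)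
  have Ksums: "(\<lambda>i. R i x \<bullet> x) sums (K x \<bullet> x)" for x
    unfolding K b_def by (rule summable_sums[OF smR])
  have RR: "adj (C i) o\<^sub>L Q o\<^sub>L C i = R i" for i by (simp add: R_def)
  have eq: "sandwich_sum C Q = K"
    unfolding sandwich_sum_def RR
  proof (rule the_equality)
    fix K' assume K': "self_adjoint K' \<and> (\<forall>x. (\<lambda>i. R i x \<bullet> x) sums (K' x \<bullet> x))"
    then show "K' = K" using Ks Ksums by (blast intro: self_adjoint_eqI sums_unique2)
  qed (use Ks Ksums in auto)
  show "self_adjoint (sandwich_sum C Q)"
    "(\<lambda>i. (adj (C i) o\<^sub>L Q o\<^sub>L C i) x \<bullet> x) sums (sandwich_sum C Q x \<bullet> x)"
    using Ks Ksums unfolding eq R_def by auto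
  show "norm (sandwich_sum C Q) \<le> k"
    unfolding eq using bq k by (intro self_adjoint_norm_le Ks) (simp_all add: K b_def)
qed

lemma sandwich_sum_eqI:
  fixes C :: "nat \<Rightarrow> 'h::{real_inner,banach} \<Rightarrow>\<^sub>L 'h"
  assumes "self_adjoint K" "\<And>x. (\<lambda>i. (adj (C i) o\<^sub>L Q o\<^sub>L C i) x \<bullet> x) sums (K x \<bullet> x)"
  shows "sandwich_sum C Q = K"
  unfolding sandwich_sum_def using assms
  by (intro the_equality) (auto intro: self_adjoint_eqI sums_unique2)

section \<open>Uniform boundedness and semigroups\<close>

text \<open>Baire category: the closed sets F n cover the space, so one of them contains a ball.
  Later it bounds the semigroup and each strongly continuous P on compact intervals.\<close>

theorem banach_steinhaus:
  fixes B :: "'i \<Rightarrow> 'a::banach \<Rightarrow>\<^sub>L 'b::real_normed_vector"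
  assumes pw: "\<And>x. bounded ((\<lambda>i. B i x) ` I)"
  shows "\<exists>M>0. \<forall>i\<in>I. norm (B i) \<le> M"
proof -
  define F where "F = (\<lambda>n::nat. {x. \<forall>i\<in>I. norm (B i x) \<le> real n})"
  have cl: "closed (F n)" for n
  proof -
    have "F n = (\<Inter>i\<in>I. {x. norm (B i x) \<le> real n})" by (auto simp: F_def)
    then show ?thesis by (auto intro!: closed_INT closed_Collect_le continuous_intros)
  qed
  have cover: "\<Union>(range F) = UNIV"
  proof -
    have "\<exists>n. x \<in> F n" for x
    proof -
      obtain K where K: "\<And>i. i \<in> I \<Longrightarrow> norm (B i x) \<le> K"
        using pw[of x] unfolding bounded_iff by auto
      obtain n where "K \<le> real n" using real_arch_simple by blast
      then have "x \<in> F n" using K by (fastforce simp: F_def)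
      then show ?thesis ..
    qed
    then show ?thesis by blast
  qed
  obtain n where n: "interior (F n) \<noteq> {}"
  proof -
    have "\<exists>n. interior (F n) \<noteq> {}"
    proof (rule ccontr)
      assume "\<nexists>n. interior (F n) \<noteq> {}"
      then have "Met_TC.mtopology interior_of \<Union>(range F) = {}"
        using cl by (intro Met_TC.metric_Baire_category_alt) (auto simp: complete_UNIV)
      then show False using cover by simp
    qed
    then show ?thesis using that by blast
  qed
  then obtain x0 e where e: "e > 0" "ball x0 e \<subseteq> F n" by (auto simp: mem_interior)
  \<comment> \<open>For |y| = e / 2 both x0 and x0 + y lie in \<open>F n\<close>, so B i y has norm
    at most 2 n; rescaling gives 4 n / e.\<close>
  have le: "norm (B i) \<le> 4 * real n / e" if i: "i \<in> I" for i
  proof (rule norm_blinfun_bound)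
    fix x
    show "norm (B i x) \<le> 4 * real n / e * norm x"
    proof (cases "x = 0")
      case False
      define y where "y = (e / (2 * norm x)) *\<^sub>R x"
      have "norm y < e" using e False by (simp add: y_def)
      then have "x0 + y \<in> F n" "x0 \<in> F n" using e by (auto simp: dist_norm subset_iff)
      then have "norm (B i (x0 + y)) \<le> n" "norm (B i x0) \<le> n" using i by (auto simp: F_def)
      moreover have "B i y = B i (x0 + y) - B i x0" by (simp add: blinfun.add_right)
      ultimately have "norm (B i y) \<le> 2 * real n"
        using norm_triangle_ineq4[of "B i (x0 + y)" "B i x0"] by simp
      moreover have "norm (B i y) = e / (2 * norm x) * norm (B i x)"
        using e by (simp add: y_def blinfun.scaleR_right)
      ultimately show ?thesis using e False by (simp add: field_simps)
    qed simp
  qed (use e in simp)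
  \<comment> \<open>The summand 1 keeps the bound strictly positive when n = 0.\<close>
  show ?thesis
    using e le by (intro exI[of _ "4 * real n / e + 1"]) (force intro: add_nonneg_pos)
qed

lemma strongly_continuous_bounded:
  fixes B :: "real \<Rightarrow> 'a::banach \<Rightarrow>\<^sub>L 'b::real_normed_vector"
  assumes "compact I" "\<And>x. continuous_on I (\<lambda>t. B t x)"
  shows "\<exists>M>0. \<forall>t\<in>I. norm (B t) \<le> M"
proof (rule banach_steinhaus)
  show "bounded ((\<lambda>t. B t x) ` I)" for x
    using compact_continuous_image[OF assms(2,1)] by (rule compact_imp_bounded)
qed

text \<open>Strong convergence tolerates a moving argument when the norms stay bounded: split u t
  into a and u t - a. Needed for conjugates, where both outer factors vary with t.\<close>

lemma blinfun_apply_tendsto: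
  fixes B :: "'i \<Rightarrow> 'a::real_normed_vector \<Rightarrow>\<^sub>L 'b::real_normed_vector"
  assumes M: "eventually (\<lambda>t. norm (B t) \<le> M) F"
    and B: "((\<lambda>t. B t a) \<longlongrightarrow> b) F" and u: "(u \<longlongrightarrow> a) F"
  shows "((\<lambda>t. B t (u t)) \<longlongrightarrow> b) F"
proof -
  have "((\<lambda>t. B t (u t - a)) \<longlongrightarrow> 0) F"
  proof (rule Lim_null_comparison)
    show "eventually (\<lambda>t. norm (B t (u t - a)) \<le> M * norm (u t - a)) F"
      using M
    proof eventually_elim
      case (elim t)
      have "norm (B t (u t - a)) \<le> norm (B t) * norm (u t - a)" by (rule norm_blinfun)
      also have "\<dots> \<le> M * norm (u t - a)" using elim by (intro mult_right_mono) auto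
      finally show ?case .
    qed
    have "((\<lambda>t. M * norm (u t - a)) \<longlongrightarrow> M * norm (a - a)) F" by (intro tendsto_intros u)
    then show "((\<lambda>t. M * norm (u t - a)) \<longlongrightarrow> 0) F" by simp
  qed
  from tendsto_add[OF this B] show ?thesis by (simp add: blinfun.diff_right)
qed

lemma c0_semigroup_bounded:
  fixes S :: "real \<Rightarrow> 'a::banach \<Rightarrow>\<^sub>L 'a"
  assumes "c0_semigroup S"
  shows "\<exists>M>0. \<forall>t\<in>{0..T}. norm (S t) \<le> M"
proof (rule strongly_continuous_bounded)
  show "continuous_on {0..T} (\<lambda>t. S t x)" for x
    using assms unfolding c0_semigroup_def by (rule_tac continuous_on_subset[of "{0..}"]) auto
qed simp

text \<open>The integrals \<open>\<integral>\<^sub>0\<^sup>d S r dr\<close> commute with the semigroup, so their adjoints map into the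
  subspace of convergence, and the joint range of these adjoints is dense.\<close>

lemma adj_semigroup_tendsto_0:
  fixes S :: "real \<Rightarrow> 'h::{real_inner,banach} \<Rightarrow>\<^sub>L 'h"
  assumes S: "c0_semigroup S"
  shows "((\<lambda>h. adj (S h) x) \<longlongrightarrow> x) (at_right 0)"
proof -
  have S0: "S 0 = id_blinfun" and Sadd: "\<And>s t. s \<ge> 0 \<Longrightarrow> t \<ge> 0 \<Longrightarrow> S (s + t) = S s o\<^sub>L S t"
    and Sc: "\<And>x. continuous_on {0..} (\<lambda>t. S t x)"
    using S by (auto simp: c0_semigroup_def)
  \<comment> \<open>The horizon 2 covers integrals over {d..d + h} with d and h at most 1.\<close>
  obtain M where M: "M > 0" "\<And>t. t \<in> {0..2} \<Longrightarrow> norm (S t) \<le> M"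
    using c0_semigroup_bounded[OF S, of 2] by blast
  have Sint: "(\<lambda>t. S t y) integrable_on {a..b}" if "0 \<le> a" for a b y
    using that by (intro integrable_continuous_real continuous_on_subset[OF Sc]) auto
  have Snorm: "norm (integral {a..b} (\<lambda>t. S t y)) \<le> M * norm y * (b - a)"
    if "0 \<le> a" "a \<le> b" "b \<le> 2" for a b y
  proof (rule integral_bound)
    show "continuous_on {a..b} (\<lambda>t. S t y)" using that by (intro continuous_on_subset[OF Sc]) auto
    fix t assume "t \<in> {a..b}"
    then have "norm (S t) \<le> M" using that by (intro M) auto
    then show "norm (S t y) \<le> M * norm y"
      by (meson mult_right_mono norm_blinfun norm_ge_zero order_trans)
  qed (use that in auto)
  have ex: "\<exists>A :: 'h \<Rightarrow>\<^sub>L 'h. \<forall>y. A y = integral {0..d} (\<lambda>t. S t y)" if "0 < d" "d \<le> 1" for d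
  proof -
    have "bounded_linear (\<lambda>y. integral {0..d} (\<lambda>t. S t y))"
    proof (rule bounded_linear_intro[where K = "M * d"])
      show "norm (integral {0..d} (\<lambda>t. S t y)) \<le> norm y * (M * d)" for y
        using Snorm[of 0 d y] that by (simp add: mult_ac)
    qed (simp_all add: blinfun.add_right blinfun.scaleR_right integral_add Sint)
    then show ?thesis by (metis bounded_linear_Blinfun_apply)
  qed
  obtain A :: "real \<Rightarrow> 'h \<Rightarrow>\<^sub>L 'h"
    where A: "\<And>d y. 0 < d \<Longrightarrow> d \<le> 1 \<Longrightarrow> A d y = integral {0..d} (\<lambda>t. S t y)"
    using ex by metis
  define V where "V = {x. ((\<lambda>h. adj (S h) x) \<longlongrightarrow> x) (at_right 0)}"
  have evM: "eventually (\<lambda>h. norm (adj (S h)) \<le> M) (at_right 0)"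
    unfolding eventually_at_right_field
    by (rule exI[of _ 2]) (auto intro: order_trans[OF norm_adj_le M(2)])
  have sub: "subspace V"
    unfolding V_def subspace_def
    by (auto simp: blinfun.add_right blinfun.scaleR_right intro!: tendsto_intros)
  \<comment> \<open>Splitting into three terms, with M bounding the adjoints near 0.\<close>
  have cl: "closed V"
    unfolding closed_sequential_limits
  proof (intro allI impI)
    fix v l assume v: "(\<forall>n. v n \<in> V) \<and> v \<longlonglongrightarrow> l"
    show "l \<in> V"
      unfolding V_def mem_Collect_eq
    proof (rule tendstoI)
      fix e :: real assume e: "e > 0"
      have "(\<lambda>n. (M + 1) * norm (v n - l)) \<longlonglongrightarrow> (M + 1) * norm (l - l)"
        by (intro tendsto_intros) (use v in blast)
      then have "\<exists>n. (M + 1) * norm (v n - l) < e / 2"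
        using e by (fastforce dest!: order_tendstoD(2)[of _ _ _ "e / 2"] simp: eventually_sequentially)
      then obtain n where n: "(M + 1) * norm (v n - l) < e / 2" by blast
      have "((\<lambda>h. adj (S h) (v n)) \<longlongrightarrow> v n) (at_right 0)" using v by (auto simp: V_def)
      then have "eventually (\<lambda>h. dist (adj (S h) (v n)) (v n) < e / 2) (at_right 0)"
        using e by (intro tendstoD) auto
      with evM show "eventually (\<lambda>h. dist (adj (S h) l) l < e) (at_right 0)"
      proof eventually_elim
        case (elim h)
        have "adj (S h) l - l = (adj (S h) (v n) - v n) - adj (S h) (v n - l) + (v n - l)"
          by (simp add: blinfun.diff_right)
        then have "norm (adj (S h) l - l)
            \<le> norm (adj (S h) (v n) - v n) + norm (adj (S h) (v n - l)) + norm (v n - l)"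
          by (simp only:) (intro norm_triangle_le add_right_mono norm_triangle_ineq4)
        also have "norm (adj (S h) (v n - l)) \<le> M * norm (v n - l)"
          using elim(1) by (meson mult_right_mono norm_blinfun norm_ge_zero order_trans)
        finally show ?case using elim(2) n by (simp add: dist_norm algebra_simps)
      qed
    qed
  qed
  have range: "adj (A d) x \<in> V" if d: "0 < d" "d \<le> 1" for x d
  proof -
    \<comment> \<open>Shifting the interval of integration changes only its two end pieces of length
      h, so \<open>A d o\<^sub>L S h\<close> tends to \<open>A d\<close> in operator norm. Norm
      convergence passes to adjoints; strong convergence in general does not.\<close>
    have bd: "norm ((A d o\<^sub>L S h) - A d) \<le> 2 * M * h" if h: "0 < h" "h \<le> 1" for h
    proof (rule norm_blinfun_bound)
      fix y
      have "(A d o\<^sub>L S h) y = integral {0..d} (\<lambda>t. S (t + h) y)"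
        using d h by (auto simp: A Sadd intro!: integral_cong)
      also have "\<dots> = integral {0..d} ((\<lambda>t. S t y) \<circ> (+) h)"
        by (simp add: comp_def add.commute)
      also have "\<dots> = integral {h..d + h} (\<lambda>t. S t y)"
        by (simp add: integral_shift_Icc_real)
      finally have 1: "(A d o\<^sub>L S h) y = integral {h..d + h} (\<lambda>t. S t y)" .
      have 2: "integral {0..h} (\<lambda>t. S t y) + integral {h..d + h} (\<lambda>t. S t y)
          = integral {0..d + h} (\<lambda>t. S t y)"
        using d h by (intro Henstock_Kurzweil_Integration.integral_combine Sint) auto
      have 3: "integral {0..d} (\<lambda>t. S t y) + integral {d..d + h} (\<lambda>t. S t y)
          = integral {0..d + h} (\<lambda>t. S t y)"
        using d h by (intro Henstock_Kurzweil_Integration.integral_combine Sint) auto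
      have "((A d o\<^sub>L S h) - A d) y
          = integral {d..d + h} (\<lambda>t. S t y) - integral {0..h} (\<lambda>t. S t y)"
        using 1 2 3 d by (simp add: blinfun.diff_left A algebra_simps)
      then have "norm (((A d o\<^sub>L S h) - A d) y)
          \<le> norm (integral {d..d + h} (\<lambda>t. S t y)) + norm (integral {0..h} (\<lambda>t. S t y))"
        by (simp add: norm_triangle_ineq4)
      also have "\<dots> \<le> M * norm y * h + M * norm y * h"
        using Snorm[of d "d + h" y] Snorm[of 0 h y] d h by (intro add_mono) auto
      finally show "norm (((A d o\<^sub>L S h) - A d) y) \<le> 2 * M * h * norm y" by (simp add: mult_ac)
    qed (use M h in simp)
    have "((\<lambda>h. adj (S h) (adj (A d) x) - adj (A d) x) \<longlongrightarrow> 0) (at_right 0)"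
    proof (rule Lim_null_comparison)
      show "eventually (\<lambda>h. norm (adj (S h) (adj (A d) x) - adj (A d) x) \<le> 2 * M * h * norm x)
          (at_right 0)"
        unfolding eventually_at_right_field
      proof (intro exI[of _ 1] conjI allI impI)
        fix h :: real assume h: "0 < h" "h < 1"
        have "adj (S h) (adj (A d) x) - adj (A d) x = adj ((A d o\<^sub>L S h) - A d) x"
          by (simp add: adj_diff adj_compose blinfun.diff_left)
        also have "norm \<dots> \<le> norm (adj ((A d o\<^sub>L S h) - A d)) * norm x" by (rule norm_blinfun)
        also have "\<dots> \<le> 2 * M * h * norm x"
          using h by (intro mult_right_mono order_trans[OF norm_adj_le bd]) auto
        finally show "norm (adj (S h) (adj (A d) x) - adj (A d) x) \<le> 2 * M * h * norm x" .
      qed simp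
      have "((\<lambda>h. 2 * M * h * norm x) \<longlongrightarrow> 2 * M * 0 * norm x) (at_right 0)"
        by (intro tendsto_intros)
      then show "((\<lambda>h. 2 * M * h * norm x) \<longlongrightarrow> 0) (at_right 0)" by simp
    qed
    then show ?thesis unfolding V_def by (simp add: LIM_zero_cancel)
  qed
  obtain p where p: "p \<in> V" "\<And>v. v \<in> V \<Longrightarrow> (x - p) \<bullet> v = 0"
    using closed_subspace_decomp[OF sub cl] by blast
  define y where "y = x - p"
  \<comment> \<open>Orthogonality of y to the element adj (A d) (A d y) of V says that A d y has
    norm 0.\<close>
  have Ay: "A d y = 0" if "0 < d" "d \<le> 1" for d
    using p(2)[OF range[OF that, of "A d y"]] by (simp add: y_def[symmetric] adj_inner' )
  \<comment> \<open>The mean values of S t y over {0..u} approach y as u shrinks, yet all of them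
    vanish.\<close>
  have "norm y \<le> e" if e: "e > 0" for e
  proof -
    obtain d where d: "d > 0" "\<And>t. 0 \<le> t \<Longrightarrow> t < d \<Longrightarrow> norm (S t y - y) < e"
      using Sc[of y, unfolded continuous_on_iff, rule_format, of 0 e] e
      by (auto simp: dist_norm S0)
    define u where "u = min (d / 2) 1"
    have u: "0 < u" "u \<le> 1" "u < d" using d by (auto simp: u_def)
    have "norm (integral {0..u} (\<lambda>t. S t y - y)) \<le> e * (u - 0)"
    proof (rule integral_bound)
      show "continuous_on {0..u} (\<lambda>t. S t y - y)"
        by (intro continuous_intros continuous_on_subset[OF Sc]) auto
    qed (use u d in \<open>auto intro: less_imp_le\<close>)
    also have "integral {0..u} (\<lambda>t. S t y - y) = - (u *\<^sub>R y)"
      using Ay[OF u(1,2)] u by (subst integral_diff) (auto simp: Sint A)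
    finally show ?thesis using u by simp
  qed
  then have "y = 0" by (metis dense_ge norm_le_zero_iff)
  then show ?thesis using p(1) by (simp add: V_def y_def)
qed

text \<open>The increment from r to r + h is adj (S r) applied to adj (S h) x - x. Factoring out the
  smaller of the two times covers left and right increments with one d, so the limit at 0
  suffices.\<close>

lemma adj_semigroup_continuous_on:
  fixes S :: "real \<Rightarrow> 'h::{real_inner,banach} \<Rightarrow>\<^sub>L 'h"
  assumes S: "c0_semigroup S"
  shows "continuous_on {0..} (\<lambda>t. adj (S t) x)"
  unfolding continuous_on_iff
proof (intro ballI allI impI)
  fix t e :: real assume t: "t \<in> {0..}" and e: "e > 0"
  have Sadd: "\<And>s t. s \<ge> 0 \<Longrightarrow> t \<ge> 0 \<Longrightarrow> S (s + t) = S s o\<^sub>L S t"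
    using S by (auto simp: c0_semigroup_def)
  obtain M where M: "M > 0" "\<And>r. r \<in> {0..t + 1} \<Longrightarrow> norm (S r) \<le> M"
    using c0_semigroup_bounded[OF S, of "t + 1"] by blast
  have "eventually (\<lambda>h. dist (adj (S h) x) x < e / M) (at_right 0)"
    using adj_semigroup_tendsto_0[OF S] e M by (intro tendstoD) auto
  then obtain d where d: "d > 0" "\<And>h. 0 < h \<Longrightarrow> h < d \<Longrightarrow> norm (adj (S h) x - x) < e / M"
    unfolding eventually_at_right_field dist_norm by blast
  have step: "norm (adj (S (r + h)) x - adj (S r) x) < e"
    if "0 \<le> r" "r \<le> t + 1" "0 < h" "h < d" for r h
  proof -
    have "adj (S (r + h)) x - adj (S r) x = adj (S r) (adj (S h) x - x)"
      using that by (simp add: Sadd add.commute[of r h] adj_compose blinfun.diff_right)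
    also have "norm \<dots> \<le> norm (adj (S r)) * norm (adj (S h) x - x)" by (rule norm_blinfun)
    also have "\<dots> \<le> M * norm (adj (S h) x - x)"
      using that by (intro mult_right_mono order_trans[OF norm_adj_le M(2)]) auto
    also have "\<dots> < M * (e / M)" using that d M by (intro mult_strict_left_mono) auto
    finally show ?thesis using M by simp
  qed
  show "\<exists>d>0. \<forall>r\<in>{0..}. dist r t < d \<longrightarrow> dist (adj (S r) x) (adj (S t) x) < e"
  proof (intro exI[of _ "min d 1"] conjI ballI impI)
    fix r assume r: "r \<in> {0..}" "dist r t < min d 1"
    consider "r = t" | "r < t" | "r > t" by linarith
    then show "dist (adj (S r) x) (adj (S t) x) < e"
    proof cases
      case 2
      then show ?thesis using step[of r "t - r"] r by (auto simp: dist_norm norm_minus_commute)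
    next
      case 3
      then show ?thesis using step[of t "r - t"] r t by (auto simp: dist_norm)
    qed (use e in simp)
  qed (use d in simp)
qed

section \<open>Measurability\<close>

text \<open>Pettis in a separable space: an open set is a countable union of closed balls with
  centre in a dense D and rational radius, and each ball is cut out by countably many scalar
  inequalities, one for each d in D.\<close>

lemma borel_measurable_weakI:
  fixes f :: "'a \<Rightarrow> 'h::{real_inner,second_countable_topology}"
  assumes f: "\<And>y. (\<lambda>x. f x \<bullet> y) \<in> borel_measurable M"
  shows "f \<in> borel_measurable M"
proof (rule borel_measurableI)
  obtain D :: "'h set" where cD: "countable D" and D: "\<And>X. open X \<Longrightarrow> X \<noteq> {} \<Longrightarrow> \<exists>d\<in>D. d \<in> X"
    by (erule countable_dense_setE)
  have dense: "closure D = UNIV"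
  proof -
    have "x \<in> closure D" for x
      unfolding closure_approachable
    proof (intro allI impI)
      fix e :: real assume "e > 0"
      then show "\<exists>y\<in>D. dist y x < e" using D[of "ball x e"] by (auto simp: dist_commute)
    qed
    then show ?thesis by blast
  qed
  have norm_le_iff: "norm z \<le> r \<longleftrightarrow> (\<forall>d\<in>D. z \<bullet> d \<le> r * norm d)" if "0 \<le> r" for z :: 'h and r
  proof
    assume "norm z \<le> r"
    then show "\<forall>d\<in>D. z \<bullet> d \<le> r * norm d"
      by (meson mult_right_mono norm_cauchy_schwarz norm_ge_zero order_trans)
  next
    assume "\<forall>d\<in>D. z \<bullet> d \<le> r * norm d"
    then have "closure D \<subseteq> {d. z \<bullet> d \<le> r * norm d}"
      by (intro closure_minimal closed_Collect_le continuous_intros) auto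
    then show "norm z \<le> r"
      using that dense by (intro norm_le_if_inner_le) auto
  qed
  have cball: "f -` cball z r \<inter> space M \<in> sets M" if "0 \<le> r" for z r
  proof -
    have "f -` cball z r \<inter> space M = {x \<in> space M. \<forall>d\<in>D. f x \<bullet> d - z \<bullet> d \<le> r * norm d}"
      using norm_le_iff[OF that]
      by (auto simp: dist_norm norm_minus_commute[of z] inner_diff_left)
    also have "\<dots> \<in> sets M"
      using f by (intro sets.sets_Collect_countable_All'[OF _ cD] borel_measurable_le borel_measurable_diff) auto
    finally show ?thesis .
  qed
  fix U :: "'h set" assume U: "open U"
  define I where "I = {(d, q). d \<in> D \<and> q \<in> \<rat> \<and> 0 \<le> q \<and> cball d q \<subseteq> U}"
  have "countable (D \<times> (\<rat> :: real set))" using cD countable_rat by auto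
  then have cI: "countable I" by (rule countable_subset[rotated]) (auto simp: I_def)
  have "U = (\<Union>(d, q)\<in>I. cball d q)"
  proof (intro equalityI subsetI)
    fix x assume "x \<in> U"
    then obtain e where e: "e > 0" "ball x e \<subseteq> U" using U open_contains_ball by blast
    obtain d where d: "d \<in> D" "dist x d < e / 4" using D[of "ball x (e / 4)"] e by auto
    obtain q where q: "q \<in> \<rat>" "e / 4 < q" "q < e / 2"
      using Rats_dense_in_real[of "e / 4" "e / 2"] e by auto
    have "cball d q \<subseteq> ball x e"
    proof
      fix y assume "y \<in> cball d q"
      then show "y \<in> ball x e" using dist_triangle[of x y d] d q by auto
    qed
    then have "(d, q) \<in> I" using d q e by (auto simp: I_def)
    moreover have "x \<in> cball d q" using d q by (auto simp: dist_commute)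
    ultimately show "x \<in> (\<Union>(d, q)\<in>I. cball d q)" by blast
  qed (auto simp: I_def)
  then have "f -` U \<inter> space M = (\<Union>(d, q)\<in>I. f -` cball d q \<inter> space M)" by auto
  also have "\<dots> \<in> sets M"
    by (rule sets.countable_UN'[OF cI]) (auto simp: I_def intro: cball)
  finally show "f -` U \<inter> space M \<in> sets M" .
qed

text \<open>Approximate u by functions with finitely many values, where only L r z with fixed z
  occurs; continuity of each L r passes to the limit. Measurability of L in operator norm is
  avoided.\<close>

lemma borel_measurable_blinfun_apply_pw:
  fixes L :: "'a \<Rightarrow> 'b::{real_normed_vector,second_countable_topology} \<Rightarrow>\<^sub>L 'c::real_normed_vector"
  assumes L: "\<And>z. (\<lambda>r. L r z) \<in> borel_measurable M" and u: "u \<in> borel_measurable M"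
  shows "(\<lambda>r. L r (u r)) \<in> borel_measurable M"
proof -
  obtain F where F: "\<And>i. simple_function M (F i)" "\<And>x. x \<in> space M \<Longrightarrow> (\<lambda>i. F i x) \<longlonglongrightarrow> u x"
    using borel_measurable_implies_sequence_metric[OF u] by blast
  show ?thesis
  proof (rule borel_measurable_LIMSEQ_metric)
    fix i
    have "F i \<in> measurable M (count_space (F i ` space M))"
      using F(1)[of i] unfolding simple_function_def by (subst measurable_count_space_eq2) auto
    then show "(\<lambda>r. L r (F i r)) \<in> borel_measurable M"
      using F(1)[of i] L unfolding simple_function_def
      by (rule_tac measurable_compose_countable'[where f = "\<lambda>z r. L r z" and I = "F i ` space M"])
        (auto intro: countable_finite)
  next
    fix x assume "x \<in> space M"
    from F(2)[OF this] show "(\<lambda>i. L x (F i x)) \<longlonglongrightarrow> L x (u x)" by (intro tendsto_intros)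
  qed
qed

text \<open>Rests on completeness of Lebesgue measure: every subset of a null set is
  measurable.\<close>

lemma lebesgue_on_measurable_AE:
  fixes f g :: "real \<Rightarrow> 'b::topological_space"
  assumes f: "f \<in> borel_measurable (lebesgue_on S)" and S: "S \<in> sets lebesgue"
    and ae: "AE x in lebesgue_on S. f x = g x"
  shows "g \<in> borel_measurable (lebesgue_on S)"
proof (rule borel_measurableI)
  fix U :: "'b set" assume U: "open U"
  obtain N where N: "N \<in> null_sets (lebesgue_on S)"
      "{x \<in> space (lebesgue_on S). f x \<noteq> g x} \<subseteq> N"
    using ae by (auto elim!: AE_E simp: null_sets_def)
  have sub: "X \<in> sets (lebesgue_on S)" if "X \<subseteq> N" for X
  proof -
    have "N \<in> null_sets lebesgue" using N(1) S by (simp add: null_sets_restrict_space)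
    then have "X \<in> null_sets lebesgue" using that by (rule completion.complete2[rotated])
    moreover have "X \<subseteq> S"
      using that N(1) sets.sets_into_space[of N "lebesgue_on S"] by (auto simp: null_sets_def)
    ultimately show ?thesis using S by (auto simp: sets_restrict_space_iff null_sets_def)
  qed
  have "g -` U \<inter> space (lebesgue_on S)
      = (f -` U \<inter> space (lebesgue_on S) - N) \<union> ((g -` U \<inter> space (lebesgue_on S)) \<inter> N)"
    using N(2) by auto
  also have "\<dots> \<in> sets (lebesgue_on S)"
    using N(1) measurable_sets[OF f, of U] U sub[OF Int_lower2, of "g -` U \<inter> space (lebesgue_on S)"]
    by (auto simp: null_sets_def)
  finally show "g -` U \<inter> space (lebesgue_on S) \<in> sets (lebesgue_on S)" .
qed

text \<open>The coefficients live on an open interval, the integrals of the mild equation on closed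
  ones; on a single end point every function is measurable.\<close>

lemma lebesgue_on_closed_ivl_measurable:
  fixes g :: "real \<Rightarrow> 'b::topological_space"
  assumes g: "g \<in> borel_measurable (lebesgue_on {a<..<b})" and "a \<le> t"
  shows "g \<in> borel_measurable (lebesgue_on {t..b})"
proof (rule measurable_piecewise_restrict[where C = "{{t<..<b}, {t}, {b}}"])
  fix \<Omega> assume "\<Omega> \<in> {{t<..<b}, {t}, {b}}"
  then consider "\<Omega> = {t<..<b}" | x where "\<Omega> = {x}" by blast
  then show "g \<in> borel_measurable (restrict_space (lebesgue_on {t..b}) \<Omega>)"
  proof cases
    case 1
    have "{t..b} \<inter> {t<..<b} = {a<..<b} \<inter> {t<..<b}" using \<open>a \<le> t\<close> by auto
    then show ?thesis
      using measurable_restrict_space1[OF g, of "{t<..<b}"] by (simp add: 1 restrict_restrict_space)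
  next
    case 2
    show ?thesis
    proof (rule borel_measurableI)
      fix U :: "'b set"
      have "g -` U \<inter> space (restrict_space (lebesgue_on {t..b}) \<Omega>)
        \<in> {{}, space (restrict_space (lebesgue_on {t..b}) \<Omega>)}"
        by (auto simp: 2 space_restrict_space)
      then show "g -` U \<inter> space (restrict_space (lebesgue_on {t..b}) \<Omega>)
          \<in> sets (restrict_space (lebesgue_on {t..b}) \<Omega>)"
        by fastforce
    qed
  qed
qed (auto simp: sets_restrict_space_iff)

text \<open>Evaluation at x maps operator-valued simple functions to vector-valued ones; the limit
  is taken after setting everything to 0 on the exceptional null set.\<close>

lemma bochner_measurable_apply:
  fixes f :: "real \<Rightarrow> 'a::real_normed_vector \<Rightarrow>\<^sub>L 'b::real_normed_vector"
  assumes "bochner_measurable T f"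
  shows "(\<lambda>s. f s x) \<in> borel_measurable (lebesgue_on {0<..<T})"
proof -
  obtain F where F: "\<And>n. simple_function (lebesgue_on {0<..<T}) (F n)"
      "AE s in lebesgue_on {0<..<T}. (\<lambda>n. F n s) \<longlonglongrightarrow> f s"
    using assms unfolding bochner_measurable_def by blast
  define M where "M = lebesgue_on {0<..<T}"
  have F': "(\<lambda>s. F n s x) \<in> borel_measurable M" for n
    using simple_function_compose1[OF F(1), of "\<lambda>B. blinfun_apply B x"]
    unfolding M_def by (rule borel_measurable_simple_function)
  obtain N where N: "N \<in> null_sets M"
      "{s \<in> space M. \<not> (\<lambda>n. F n s) \<longlonglongrightarrow> f s} \<subseteq> N"
    using F(2) unfolding M_def by (auto elim!: AE_E simp: null_sets_def)
  define g where "g = (\<lambda>s. if s \<in> N then 0 else f s x)"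
  have "g \<in> borel_measurable M"
  proof (rule borel_measurable_LIMSEQ_metric)
    show "(\<lambda>s. if s \<in> N then 0 else F n s x) \<in> borel_measurable M" for n
      using N(1) F' by (intro measurable_If_set) (auto simp: null_sets_def)
    fix s assume s: "s \<in> space M"
    show "(\<lambda>n. if s \<in> N then 0 else F n s x) \<longlonglongrightarrow> g s"
      using s N(2) by (auto simp: g_def intro!: tendsto_intros)
  qed
  moreover have "AE s in M. g s = f s x"
    by (rule AE_I'[OF N(1)]) (auto simp: g_def)
  ultimately show ?thesis unfolding M_def by (intro lebesgue_on_measurable_AE[where f = g and g = "\<lambda>s. f s x"]) auto
qed

section \<open>The kernel estimate\<close>

text \<open>Translation and reflection of x^-g on [0, T - t], finite because g < 1; nonnegativity
  turns the gauge integral into a Lebesgue integral.\<close>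

lemma
  fixes g t T :: real
  assumes g: "g < 1" and t: "t \<le> T"
  shows integrable_powr_left: "integrable (lebesgue_on {t..T}) (\<lambda>r. (r - t) powr (- g))"
    and integral_powr_left:
      "(\<integral>r. (r - t) powr (- g) \<partial>lebesgue_on {t..T}) = (T - t) powr (1 - g) / (1 - g)"
    and integrable_powr_right: "integrable (lebesgue_on {t..T}) (\<lambda>r. (T - r) powr (- g))"
    and integral_powr_right:
      "(\<integral>r. (T - r) powr (- g) \<partial>lebesgue_on {t..T}) = (T - t) powr (1 - g) / (1 - g)"
proof -
  define I where "I = (T - t) powr (1 - g) / (1 - g)"
  have 0: "((\<lambda>x. x powr (- g)) has_integral I) (cbox 0 (T - t))"
    using has_integral_powr_from_0[of "- g" "T - t"] g t by (simp add: I_def add.commute)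
  have 1: "((\<lambda>r. (r - t) powr (- g)) has_integral I) {t..T}"
    using has_integral_affinity[OF 0, of 1 "- t"] t by (simp add: image_affinity_cbox algebra_simps)
  have 2: "((\<lambda>r. (T - r) powr (- g)) has_integral I) {t..T}"
    using has_integral_affinity[OF 0, of "- 1" T] t by (simp add: image_affinity_cbox algebra_simps)
  have *: "integrable (lebesgue_on {t..T}) f \<and> integral\<^sup>L (lebesgue_on {t..T}) f = I"
    if f: "(f has_integral I) {t..T}" and nn: "\<And>x. f x \<ge> 0" for f :: "real \<Rightarrow> real"
  proof -
    have "f absolutely_integrable_on {t..T}"
      using f nn by (intro nonnegative_absolutely_integrable_1) auto
    then have "integrable (lebesgue_on {t..T}) f"
      by (simp add: integrable_restrict_space set_integrable_def)
    then show ?thesis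
      using f by (simp add: lebesgue_integral_eq_integral integral_unique)
  qed
  show "integrable (lebesgue_on {t..T}) (\<lambda>r. (r - t) powr (- g))"
    "(\<integral>r. (r - t) powr (- g) \<partial>lebesgue_on {t..T}) = (T - t) powr (1 - g) / (1 - g)"
    "integrable (lebesgue_on {t..T}) (\<lambda>r. (T - r) powr (- g))"
    "(\<integral>r. (T - r) powr (- g) \<partial>lebesgue_on {t..T}) = (T - t) powr (1 - g) / (1 - g)"
    using *[OF 1] *[OF 2] by (simp_all add: I_def)
qed

text \<open>Replace the larger of a and b by the smaller one, which only increases its negative
  power.\<close>

lemma powr_minus_mult_le:
  fixes a b p q :: real
  assumes "a > 0" "b > 0" "p \<ge> 0" "q \<ge> 0"
  shows "a powr (- p) * b powr (- q) \<le> a powr (- (p + q)) + b powr (- (p + q))"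
proof (cases "a \<le> b")
  case True
  have "a powr (- p) * b powr (- q) \<le> a powr (- p) * a powr (- q)"
    using assms True by (intro mult_left_mono powr_mono2') auto
  also have "\<dots> = a powr (- (p + q))" by (simp add: powr_add[symmetric])
  finally show ?thesis by (simp add: add_increasing2)
next
  case False
  have "a powr (- p) * b powr (- q) \<le> b powr (- p) * b powr (- q)"
    using assms False by (intro mult_right_mono powr_mono2') auto
  also have "\<dots> = b powr (- (p + q))" by (simp add: powr_add[symmetric])
  finally show ?thesis by (simp add: add_increasing)
qed

lemma powr_add_le:
  fixes a b p :: real
  assumes "a > 0" "b > 0" "0 \<le> p" "p \<le> 1"
  shows "(a + b) powr p \<le> a powr p + b powr p"
proof -
  have "(a + b) powr p = (a + b) powr (p - 1) * a + (a + b) powr (p - 1) * b"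
    using assms powr_mult_base[of "a + b" "p - 1"] by (simp add: algebra_simps)
  also have "\<dots> \<le> a powr (p - 1) * a + b powr (p - 1) * b"
    using assms by (intro add_mono mult_right_mono powr_mono2') auto
  also have "\<dots> = a powr p + b powr p"
    using assms powr_mult_base[of a "p - 1"] powr_mult_base[of b "p - 1"]
    by (simp add: mult.commute)
  finally show ?thesis .
qed

text \<open>Subadditivity of the power p, multiplied by u^-p v^-p. With u = r - t and v = T - r the
  sum u + v is T - t, whence the single factor (T - t)^-p outside the integral.\<close>

lemma powr_product_le:
  fixes u v p :: real
  assumes "u > 0" "v > 0" "0 \<le> p" "p \<le> 1"
  shows "u powr (- p) * v powr (- p) \<le> (u + v) powr (- p) * (u powr (- p) + v powr (- p))"
proof -
  have "(u + v) powr p * (u powr (- p) * v powr (- p))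
      \<le> (u powr p + v powr p) * (u powr (- p) * v powr (- p))"
    using assms by (intro mult_right_mono powr_add_le) auto
  also have "\<dots> = u powr (- p) + v powr (- p)"
    using assms by (simp add: powr_minus field_simps)
  finally have "(u + v) powr (- p) * ((u + v) powr p * (u powr (- p) * v powr (- p)))
      \<le> (u + v) powr (- p) * (u powr (- p) + v powr (- p))"
    by (intro mult_left_mono) auto
  then show ?thesis using assms by (simp add: powr_minus field_simps)
qed

text \<open>From x \<le> exp x, raised to a power at most 1. Converts exponential decay into a
  negative power of \<beta>.\<close>

lemma exp_minus_le_powr:
  fixes x e :: real
  assumes "x > 0" "0 \<le> e" "e \<le> 1"
  shows "exp (- x) \<le> x powr (- e)"
proof -
  have "x powr e \<le> exp x powr e"
    using assms exp_ge_add_one_self[of x] by (intro powr_mono2) linarith+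
  also have "\<dots> \<le> exp x" using assms by (simp add: powr_def)
  finally show ?thesis using assms by (simp add: powr_minus exp_minus le_imp_inverse_le)
qed

section \<open>The Lyapunov operator\<close>

locale lyapunov =
  fixes T c \<alpha> M :: real
    and S :: "real \<Rightarrow> 'h::{real_inner,banach,second_countable_topology} \<Rightarrow>\<^sub>L 'h"
    and A0 :: "real \<Rightarrow> 'h \<Rightarrow>\<^sub>L 'h"
    and C :: "nat \<Rightarrow> real \<Rightarrow> 'h \<Rightarrow>\<^sub>L 'h"
  assumes T: "T > 0" and c: "c > 0" and \<alpha>: "0 < \<alpha>" "\<alpha> < 1 / 2"
    and S: "c0_semigroup S"
    and M: "M > 0" "\<And>t. t \<in> {0..T} \<Longrightarrow> norm (S t) \<le> M"
    and A0_measurable: "\<And>x. (\<lambda>s. A0 s x) \<in> borel_measurable (lebesgue_on {0<..<T})"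
    and C_measurable: "\<And>j x. (\<lambda>s. C j s x) \<in> borel_measurable (lebesgue_on {0<..<T})"
    and A0_bound: "\<And>s. s \<in> {0..<T} \<Longrightarrow> norm (A0 s) \<le> c * (T - s) powr (- \<alpha>)"
    and C_summable: "\<And>t s x. t > 0 \<Longrightarrow> s \<in> {0..<T} \<Longrightarrow> summable (\<lambda>j. (norm (S t (C j s x)))\<^sup>2)"
    and C_bound: "\<And>t s x. t > 0 \<Longrightarrow> s \<in> {0..<T} \<Longrightarrow>
        (\<Sum>j. (norm (S t (C j s x)))\<^sup>2)
          \<le> c * (t powr (- 2 * \<alpha>) + (T - s) powr (- 2 * \<alpha>)) * (norm x)\<^sup>2"
begin

text \<open>One class for the inhomogeneity \<open>f\<close> and for all brackets. Self-adjointness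
  is asked only almost everywhere, as it is given for \<open>f\<close>; the growth bound is asked at
  every s < T because the iteration is followed at each s.\<close>

definition admissible :: "(real \<Rightarrow> 'h \<Rightarrow>\<^sub>L 'h) \<Rightarrow> bool" where
  "admissible L \<longleftrightarrow>
     (\<forall>x. (\<lambda>s. L s x) \<in> borel_measurable (lebesgue_on {0<..<T})) \<and>
     (AE s in lebesgue_on {0<..<T}. self_adjoint (L s)) \<and>
     (\<exists>k\<ge>0. \<forall>s\<in>{0..<T}. norm (L s) \<le> k * (T - s) powr (- 2 * \<alpha>))"

text \<open>The mild solution of P' + A^* P + P A + L = 0 with terminal value 0. The use of
  \<open>Blinfun\<close> is justified in \<open>evolve_apply\<close>.\<close>

definition evolve :: "(real \<Rightarrow> 'h \<Rightarrow>\<^sub>L 'h) \<Rightarrow> real \<Rightarrow> 'h \<Rightarrow>\<^sub>L 'h" where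
  "evolve L t =
     Blinfun (\<lambda>x. \<integral>r. (adj (S (r - t)) o\<^sub>L L r o\<^sub>L S (r - t)) x \<partial>lebesgue_on {t..T})"

lemma S_continuous: "continuous_on {0..} (\<lambda>t. S t x)"
  using S by (auto simp: c0_semigroup_def)

lemma norm_S_le: "t \<in> {0..T} \<Longrightarrow> norm (S t x) \<le> M * norm x"
  by (rule order_trans[OF norm_blinfun mult_right_mono[OF M(2)]]) auto

lemma norm_adj_S_le: "t \<in> {0..T} \<Longrightarrow> norm (adj (S t)) \<le> M"
  by (rule order_trans[OF norm_adj_le M(2)])

text \<open>The end points have measure 0, so r - t and T - r may be taken positive under every
  integral: the smoothing hypothesis says nothing at r = t, and no bound on L is available at r =
  T.\<close>

lemma AE_ivl:
  assumes "0 \<le> t" and ae: "AE r in lebesgue_on {0<..<T}. P r"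
  shows "AE r in lebesgue_on {t..T}. t < r \<and> r < T \<and> P r"
proof -
  have "AE r in lebesgue. r \<in> {0<..<T} \<longrightarrow> P r"
    using ae by (simp add: AE_restrict_space_iff)
  moreover have "AE r in lebesgue. r \<notin> {t, T}"
    by (intro AE_not_in null_sets_completionI finite_imp_null_set_lborel) simp
  ultimately have "AE r in lebesgue. r \<in> {t..T} \<longrightarrow> t < r \<and> r < T \<and> P r"
    by eventually_elim (use assms(1) in auto)
  then show ?thesis by (subst AE_restrict_space_iff) simp_all
qed

lemma AE_ivl': "0 \<le> t \<Longrightarrow> AE r in lebesgue_on {t..T}. t < r \<and> r < T"
  using AE_ivl[of t "\<lambda>_. True"] by simp

lemma norm_conjugate_le:
  assumes "r - t \<in> {0..T}"
  shows "norm ((adj (S (r - t)) o\<^sub>L Q o\<^sub>L S (r - t)) x) \<le> M\<^sup>2 * norm Q * norm x"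
proof -
  have "norm (adj (S (r - t)) (Q (S (r - t) x))) \<le> norm (adj (S (r - t))) * norm (Q (S (r - t) x))"
    by (rule norm_blinfun)
  also have "\<dots> \<le> M * (norm Q * norm (S (r - t) x))"
    using M(1) by (intro mult_mono norm_adj_S_le assms norm_blinfun) auto
  also have "\<dots> \<le> M * (norm Q * (M * norm x))"
    using M(1) by (intro mult_left_mono norm_S_le assms) auto
  finally show ?thesis by (simp add: power2_eq_square mult_ac)
qed

lemma S_shift_measurable:
  assumes "t \<in> {0..T}"
  shows "(\<lambda>r. S (r - t) x) \<in> borel_measurable (lebesgue_on {t..T})"
    and "(\<lambda>r. adj (S (r - t)) x) \<in> borel_measurable (lebesgue_on {t..T})"
proof -
  have "continuous_on {t..T} (\<lambda>r. S (r - t) x)" "continuous_on {t..T} (\<lambda>r. adj (S (r - t)) x)"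
    by (rule continuous_on_compose2[OF S_continuous] continuous_on_compose2[OF adj_semigroup_continuous_on[OF S]];
        auto intro!: continuous_intros)+
  then show "(\<lambda>r. S (r - t) x) \<in> borel_measurable (lebesgue_on {t..T})"
    "(\<lambda>r. adj (S (r - t)) x) \<in> borel_measurable (lebesgue_on {t..T})"
    by (auto intro!: continuous_imp_measurable_on_sets_lebesgue)
qed

lemma conjugate_measurable:
  fixes L :: "real \<Rightarrow> 'h \<Rightarrow>\<^sub>L 'h"
  assumes L: "\<And>x. (\<lambda>s. L s x) \<in> borel_measurable (lebesgue_on {0<..<T})" and t: "t \<in> {0..T}"
  shows "(\<lambda>r. (adj (S (r - t)) o\<^sub>L L r o\<^sub>L S (r - t)) x) \<in> borel_measurable (lebesgue_on {t..T})"
proof -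
  have L': "(\<lambda>r. L r z) \<in> borel_measurable (lebesgue_on {t..T})" for z
    using L t by (intro lebesgue_on_closed_ivl_measurable[where a = 0]) auto
  have "(\<lambda>r. L r (S (r - t) x)) \<in> borel_measurable (lebesgue_on {t..T})"
    by (rule borel_measurable_blinfun_apply_pw[OF L' S_shift_measurable(1)[OF t]])
  then show ?thesis
    unfolding blinfun_apply_blinfun_compose
    by (rule borel_measurable_blinfun_apply_pw[OF S_shift_measurable(2)[OF t]])
qed

lemma conjugate_integrable:
  assumes L: "admissible L" and t: "t \<in> {0..T}"
  shows "integrable (lebesgue_on {t..T}) (\<lambda>r. (adj (S (r - t)) o\<^sub>L L r o\<^sub>L S (r - t)) x)"
proof -
  obtain k where k: "k \<ge> 0" "\<And>s. s \<in> {0..<T} \<Longrightarrow> norm (L s) \<le> k * (T - s) powr (- 2 * \<alpha>)"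
    using L unfolding admissible_def by blast
  show ?thesis
  proof (rule Bochner_Integration.integrable_bound)
    show "integrable (lebesgue_on {t..T}) (\<lambda>r. M\<^sup>2 * k * norm x * (T - r) powr (- (2 * \<alpha>)))"
      using \<alpha> t by (intro integrable_mult_right integrable_powr_right) auto
    show "(\<lambda>r. (adj (S (r - t)) o\<^sub>L L r o\<^sub>L S (r - t)) x) \<in> borel_measurable (lebesgue_on {t..T})"
      using L t by (intro conjugate_measurable) (auto simp: admissible_def)
    have "0 \<le> t" using t by simp
    from AE_ivl'[OF this] show "AE r in lebesgue_on {t..T}.
        norm ((adj (S (r - t)) o\<^sub>L L r o\<^sub>L S (r - t)) x)
          \<le> norm (M\<^sup>2 * k * norm x * (T - r) powr (- (2 * \<alpha>)))"
    proof eventually_elim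
      case (elim r)
      have "norm ((adj (S (r - t)) o\<^sub>L L r o\<^sub>L S (r - t)) x) \<le> M\<^sup>2 * norm (L r) * norm x"
        using elim t by (intro norm_conjugate_le) auto
      also have "\<dots> \<le> M\<^sup>2 * (k * (T - r) powr (- 2 * \<alpha>)) * norm x"
        using elim t by (intro mult_right_mono mult_left_mono k) auto
      finally show ?case using k(1) by (simp add: mult_ac abs_mult)
    qed
  qed
qed

text \<open>The integrable majorant (T - r)^(-2\<alpha>) makes the integral a bounded linear
  function of x, so \<open>Blinfun\<close> returns the intended operator.\<close>

lemma evolve_apply:
  assumes L: "admissible L" and t: "t \<in> {0..T}"
  shows "evolve L t x = (\<integral>r. (adj (S (r - t)) o\<^sub>L L r o\<^sub>L S (r - t)) x \<partial>lebesgue_on {t..T})"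
proof -
  obtain k where k: "k \<ge> 0" "\<And>s. s \<in> {0..<T} \<Longrightarrow> norm (L s) \<le> k * (T - s) powr (- 2 * \<alpha>)"
    using L unfolding admissible_def by blast
  let ?\<mu> = "lebesgue_on {t..T}"
  let ?g = "\<lambda>r. adj (S (r - t)) o\<^sub>L L r o\<^sub>L S (r - t)"
  let ?p = "\<lambda>r. (T - r) powr (- (2 * \<alpha>))"
  note int = conjugate_integrable[OF L t]
  have "bounded_linear (\<lambda>x. \<integral>r. ?g r x \<partial>?\<mu>)"
  proof (rule bounded_linear_intro[where K = "M\<^sup>2 * k * (\<integral>r. ?p r \<partial>?\<mu>)"])
    fix x y and a :: real
    show "(\<integral>r. ?g r (x + y) \<partial>?\<mu>) = (\<integral>r. ?g r x \<partial>?\<mu>) + (\<integral>r. ?g r y \<partial>?\<mu>)"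
      unfolding blinfun.add_right by (rule Bochner_Integration.integral_add[OF int int])
    show "(\<integral>r. ?g r (a *\<^sub>R x) \<partial>?\<mu>) = a *\<^sub>R (\<integral>r. ?g r x \<partial>?\<mu>)"
      unfolding blinfun.scaleR_right by simp
    have "norm (\<integral>r. ?g r x \<partial>?\<mu>) \<le> (\<integral>r. norm (?g r x) \<partial>?\<mu>)" by (rule integral_norm_bound)
    also have "\<dots> \<le> (\<integral>r. M\<^sup>2 * k * norm x * ?p r \<partial>?\<mu>)"
    proof (rule integral_mono_AE)
      show "integrable ?\<mu> (\<lambda>r. M\<^sup>2 * k * norm x * ?p r)"
        using \<alpha> t by (intro integrable_mult_right integrable_powr_right) auto
      have "0 \<le> t" using t by simp
      from AE_ivl'[OF this] show "AE r in ?\<mu>. norm (?g r x) \<le> M\<^sup>2 * k * norm x * ?p r"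
      proof eventually_elim
        case (elim r)
        have "norm (?g r x) \<le> M\<^sup>2 * norm (L r) * norm x"
          using elim t by (intro norm_conjugate_le) auto
        also have "\<dots> \<le> M\<^sup>2 * (k * (T - r) powr (- 2 * \<alpha>)) * norm x"
          using elim t by (intro mult_right_mono mult_left_mono k) auto
        finally show ?case by (simp add: mult_ac)
      qed
    qed (use int in simp)
    finally show "norm (\<integral>r. ?g r x \<partial>?\<mu>) \<le> norm x * (M\<^sup>2 * k * (\<integral>r. ?p r \<partial>?\<mu>))"
      by (simp add: mult_ac)
  qed
  then show ?thesis unfolding evolve_def by (simp add: bounded_linear_Blinfun_apply)
qed

lemma quadratic_integrable:
  assumes L: "admissible L" and t: "t \<in> {0..T}"
  shows "integrable (lebesgue_on {t..T}) (\<lambda>r. L r (S (r - t) x) \<bullet> S (r - t) y)"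
proof -
  have "integrable (lebesgue_on {t..T}) (\<lambda>r. (adj (S (r - t)) o\<^sub>L L r o\<^sub>L S (r - t)) x \<bullet> y)"
    by (rule integrable_inner_left) (rule conjugate_integrable[OF L t])
  then show ?thesis by (simp add: adj_inner)
qed

text \<open>Moving the adjoint to the other side puts S (r - t) on both arguments; with C_i z as
  argument this is where the smoothing hypothesis can act.\<close>

lemma evolve_inner:
  assumes L: "admissible L" and t: "t \<in> {0..T}"
  shows "evolve L t x \<bullet> y = (\<integral>r. L r (S (r - t) x) \<bullet> S (r - t) y \<partial>lebesgue_on {t..T})"
proof -
  have "(\<integral>r. (adj (S (r - t)) o\<^sub>L L r o\<^sub>L S (r - t)) x \<bullet> y \<partial>lebesgue_on {t..T})
      = (\<integral>r. (adj (S (r - t)) o\<^sub>L L r o\<^sub>L S (r - t)) x \<partial>lebesgue_on {t..T}) \<bullet> y"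
    by (rule integral_inner_left) (rule conjugate_integrable[OF L t])
  then show ?thesis by (simp add: evolve_apply[OF L t] adj_inner)
qed

lemma evolve_self_adjoint:
  assumes L: "admissible L" and t: "t \<in> {0..T}"
  shows "self_adjoint (evolve L t)"
  unfolding self_adjoint_def
proof (intro allI)
  fix x y
  have ae: "AE r in lebesgue_on {t..T}. t < r \<and> r < T \<and> self_adjoint (L r)"
    using L t by (intro AE_ivl) (auto simp: admissible_def)
  have "evolve L t x \<bullet> y = (\<integral>r. L r (S (r - t) y) \<bullet> S (r - t) x \<partial>lebesgue_on {t..T})"
    unfolding evolve_inner[OF L t]
  proof (intro integral_cong_AE borel_measurable_integrable quadratic_integrable[OF L t])
    show "AE r in lebesgue_on {t..T}.
        L r (S (r - t) x) \<bullet> S (r - t) y = L r (S (r - t) y) \<bullet> S (r - t) x"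
      using ae by eventually_elim (simp add: self_adjoint_def inner_commute)
  qed
  then show "evolve L t x \<bullet> y = x \<bullet> evolve L t y"
    unfolding inner_commute[of x] evolve_inner[OF L t] .
qed

text \<open>Dominated convergence. Indicators put the integrals with varying lower limit on one
  measure space, and the majorant b is independent of t because each conjugation costs at most
  M^2.\<close>

lemma evolve_continuous_on:
  assumes L: "admissible L"
  shows "continuous_on {0..T} (\<lambda>t. evolve L t x)"
  unfolding continuous_on_sequentially
proof (intro allI ballI impI, elim conjE)
  fix u :: "nat \<Rightarrow> real" and a
  assume a: "a \<in> {0..T}" and u: "\<forall>n. u n \<in> {0..T}" and lim: "u \<longlonglongrightarrow> a"
  obtain k where k: "k \<ge> 0" "\<And>s. s \<in> {0..<T} \<Longrightarrow> norm (L s) \<le> k * (T - s) powr (- 2 * \<alpha>)"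
    using L unfolding admissible_def by blast
  define g where "g = (\<lambda>t r. indicator {t..T} r *\<^sub>R (adj (S (r - t)) o\<^sub>L L r o\<^sub>L S (r - t)) x)"
  define b where "b = (\<lambda>r. indicator {0..T} r *\<^sub>R (M\<^sup>2 * k * norm x * (T - r) powr (- (2 * \<alpha>))))"
  have ev: "evolve L t x = integral\<^sup>L lebesgue (g t)" and gi: "integrable lebesgue (g t)"
    if "t \<in> {0..T}" for t
    using conjugate_integrable[OF L that, of x]
    by (simp_all add: evolve_apply[OF L that] g_def integral_restrict_space integrable_restrict_space)
  have b: "integrable lebesgue b"
  proof -
    have "integrable (lebesgue_on {0..T}) (\<lambda>r. M\<^sup>2 * k * norm x * (T - r) powr (- (2 * \<alpha>)))"
      using \<alpha> T by (intro integrable_mult_right integrable_powr_right) auto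
    then show ?thesis unfolding b_def by (subst (asm) integrable_restrict_space) auto
  qed
  have ne: "AE r in lebesgue. r \<notin> {a, T}"
    by (intro AE_not_in null_sets_completionI finite_imp_null_set_lborel) simp
  have "(\<lambda>n. integral\<^sup>L lebesgue (g (u n))) \<longlonglongrightarrow> integral\<^sup>L lebesgue (g a)"
  proof (rule integral_dominated_convergence)
    show "g a \<in> borel_measurable lebesgue" "g (u n) \<in> borel_measurable lebesgue" for n
      using a u gi by (auto intro: borel_measurable_integrable)
    show "integrable lebesgue b" by (rule b)
    show "AE r in lebesgue. norm (g (u n) r) \<le> b r" for n
      using ne
    proof eventually_elim
      case (elim r)
      show ?case
      proof (cases "r \<in> {u n..T}")
        case True
        have un: "u n \<in> {0..T}" using u by blast
        have "norm ((adj (S (r - u n)) o\<^sub>L L r o\<^sub>L S (r - u n)) x) \<le> M\<^sup>2 * norm (L r) * norm x"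
          using True un by (intro norm_conjugate_le) auto
        also have "\<dots> \<le> M\<^sup>2 * (k * (T - r) powr (- 2 * \<alpha>)) * norm x"
          using elim True un by (intro mult_right_mono mult_left_mono k) auto
        finally show ?thesis using True un by (simp add: g_def b_def mult_ac)
      qed (use k(1) in \<open>simp add: g_def b_def\<close>)
    qed
    show "AE r in lebesgue. (\<lambda>n. g (u n) r) \<longlonglongrightarrow> g a r"
      using ne
    proof eventually_elim
      case (elim r)
      consider "r < a" | "r > T" | "a < r" "r < T" using elim by fastforce
      then show ?case
      proof cases
        case 1
        then have "eventually (\<lambda>n. g (u n) r = g a r) sequentially"
          using order_tendstoD(1)[OF lim, of r] by (auto elim!: eventually_mono simp: g_def)
        then show ?thesis by (rule tendsto_eventually)
      next
        case 2
        then show ?thesis by (simp add: g_def)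
      next
        case 3
        have ev: "eventually (\<lambda>n. u n < r) sequentially" using order_tendstoD(2)[OF lim, of r] 3 by auto
        have l: "(\<lambda>n. r - u n) \<longlonglongrightarrow> r - a" by (intro tendsto_intros lim)
        have ev0: "eventually (\<lambda>n. r - u n \<in> {0..}) sequentially"
          using ev by eventually_elim auto
        have "(\<lambda>n. S (r - u n) x) \<longlonglongrightarrow> S (r - a) x"
          using continuous_on_tendsto_compose[OF S_continuous l _ ev0] 3 by simp
        then have L1: "(\<lambda>n. L r (S (r - u n) x)) \<longlonglongrightarrow> L r (S (r - a) x)"
          by (rule bounded_linear.tendsto[OF blinfun.bounded_linear_right])
        have L2: "(\<lambda>n. adj (S (r - u n)) z) \<longlonglongrightarrow> adj (S (r - a)) z" for z
          using continuous_on_tendsto_compose[OF adj_semigroup_continuous_on[OF S] l _ ev0] 3 by simp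
        have "eventually (\<lambda>n. norm (adj (S (r - u n))) \<le> M) sequentially"
          using ev
        proof eventually_elim
          case (elim n)
          have "0 \<le> u n" using u by auto
          then show ?case using elim 3 by (intro norm_adj_S_le) auto
        qed
        from blinfun_apply_tendsto[OF this L2 L1]
        have "(\<lambda>n. (adj (S (r - u n)) o\<^sub>L L r o\<^sub>L S (r - u n)) x)
            \<longlonglongrightarrow> (adj (S (r - a)) o\<^sub>L L r o\<^sub>L S (r - a)) x" by simp
        moreover have "g a r = (adj (S (r - a)) o\<^sub>L L r o\<^sub>L S (r - a)) x" using 3 by (simp add: g_def)
        moreover have "eventually (\<lambda>n. (adj (S (r - u n)) o\<^sub>L L r o\<^sub>L S (r - u n)) x = g (u n) r) sequentially"
          using ev by eventually_elim (use 3 in \<open>auto simp: g_def\<close>)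
        ultimately show ?thesis by (simp only: Lim_transform_eventually)
      qed
    qed
  qed
  then show "((\<lambda>t. evolve L t x) \<circ> u) \<longlonglongrightarrow> evolve L a x"
    using a u ev by (simp add: comp_def)
qed

lemma evolve_diff:
  assumes "admissible L" "admissible L'" "admissible (\<lambda>s. L s - L' s)" "t \<in> {0..T}"
  shows "evolve (\<lambda>s. L s - L' s) t = evolve L t - evolve L' t"
proof (rule blinfun_eqI)
  fix x
  have "evolve (\<lambda>s. L s - L' s) t x
      = (\<integral>r. (adj (S (r - t)) o\<^sub>L L r o\<^sub>L S (r - t)) x - (adj (S (r - t)) o\<^sub>L L' r o\<^sub>L S (r - t)) x
          \<partial>lebesgue_on {t..T})"
    unfolding evolve_apply[OF assms(3,4)] by (simp add: blinfun.diff_left blinfun.diff_right)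
  also have "\<dots> = evolve L t x - evolve L' t x"
    unfolding evolve_apply[OF assms(1,4)] evolve_apply[OF assms(2,4)]
    by (intro Bochner_Integration.integral_diff conjugate_integrable assms)
  finally show "evolve (\<lambda>s. L s - L' s) t x = (evolve L t - evolve L' t) x"
    by (simp add: blinfun.diff_left)
qed

text \<open>Brackets are controlled only for s < T, and the remaining point T is a null set.\<close>

lemma evolve_cong:
  assumes "\<And>s. s \<in> {0..<T} \<Longrightarrow> L s = L' s" "admissible L" "admissible L'" "t \<in> {0..T}"
  shows "evolve L t = evolve L' t"
proof (rule blinfun_eqI)
  fix x
  have "0 \<le> t" using assms(4) by simp
  from AE_ivl'[OF this]
  have "AE r in lebesgue_on {t..T}. (adj (S (r - t)) o\<^sub>L L r o\<^sub>L S (r - t)) x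
      = (adj (S (r - t)) o\<^sub>L L' r o\<^sub>L S (r - t)) x"
    by eventually_elim (use assms in auto)
  then show "evolve L t x = evolve L' t x"
    unfolding evolve_apply[OF assms(2,4)] evolve_apply[OF assms(3,4)]
    using assms by (intro integral_cong_AE borel_measurable_integrable conjugate_integrable) auto
qed


section \<open>Weighted estimates\<close>

text \<open>The exponential grows with the distance to T: \<open>evolve L t\<close> sees L only at r
  > t, where this factor is smaller by exp (- \<beta> (r - t)).\<close>

definition weight :: "real \<Rightarrow> real \<Rightarrow> real" where
  "weight \<beta> s = (T - s) powr (- 2 * \<alpha>) * exp (\<beta> * (T - s))"

text \<open>Midpoint of 2\<alpha> and 1; \<epsilon> below is the distance from 2\<alpha> to this
  midpoint.\<close>

definition \<gamma> :: real where "\<gamma> = (1 + 2 * \<alpha>) / 2"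

definition \<epsilon> :: real where "\<epsilon> = (1 - 2 * \<alpha>) / 2"

text \<open>The factor 3 adds the two copies produced by the term (r - t)^(-2\<alpha>) in
  \<open>kernel_bound\<close> and the one produced by (T - t)^(-2\<alpha>).\<close>

definition majorant :: "real \<Rightarrow> real \<Rightarrow> real" where
  "majorant t r = 3 * ((r - t) powr (- \<gamma>) + (T - r) powr (- \<gamma>))"

text \<open>\<beta>^-\<epsilon> times a bound, uniform in t, for the integral of
  \<open>majorant t\<close>; 6 is 3 times the two equal integrals.\<close>

definition \<kappa> :: "real \<Rightarrow> real" where
  "\<kappa> \<beta> = \<beta> powr (- \<epsilon>) * (6 * T powr (1 - \<gamma>) / (1 - \<gamma>))"

lemma exponents: "0 < \<epsilon>" "\<epsilon> < 1" "0 < \<gamma>" "\<gamma> < 1" "2 * \<alpha> + \<epsilon> = \<gamma>" "0 < 1 - \<gamma>" "\<epsilon> \<le> \<gamma>" "2 * \<alpha> \<le> 1"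
  using \<alpha> by (simp_all add: \<gamma>_def \<epsilon>_def field_simps)

lemma weight_pos: "s < T \<Longrightarrow> 0 < weight \<beta> s"
  by (simp add: weight_def)

lemma weight_ge: "s < T \<Longrightarrow> 0 \<le> \<beta> \<Longrightarrow> (T - s) powr (- 2 * \<alpha>) \<le> weight \<beta> s"
  unfolding weight_def by (simp add: mult_le_cancel_left1)

lemma weight_le:
  "0 \<le> s \<Longrightarrow> s < T \<Longrightarrow> 0 \<le> \<beta> \<Longrightarrow> weight \<beta> s \<le> exp (\<beta> * T) * (T - s) powr (- 2 * \<alpha>)"
  unfolding weight_def by (simp add: mult_left_mono mult.commute[of "exp _"])

lemma \<kappa>_nonneg: "0 \<le> \<kappa> \<beta>"
  using exponents by (simp add: \<kappa>_def)

lemma \<kappa>_tendsto: "(\<kappa> \<longlongrightarrow> 0) at_top"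
proof -
  have "((\<lambda>\<beta>. \<beta> powr (- \<epsilon>)) \<longlongrightarrow> 0) at_top"
    by (rule tendsto_neg_powr) (use exponents in \<open>auto intro: filterlim_ident\<close>)
  from tendsto_mult_left_zero[OF this] show ?thesis unfolding \<kappa>_def .
qed

lemma majorant_integral:
  assumes t: "t \<in> {0..<T}"
  shows "integrable (lebesgue_on {t..T}) (majorant t)"
    and "\<beta> powr (- \<epsilon>) * (\<integral>r. majorant t r \<partial>lebesgue_on {t..T}) \<le> \<kappa> \<beta>"
proof -
  have i: "integrable (lebesgue_on {t..T}) (\<lambda>r. (r - t) powr (- \<gamma>))"
    "integrable (lebesgue_on {t..T}) (\<lambda>r. (T - r) powr (- \<gamma>))"
    using exponents t by (auto intro: integrable_powr_left integrable_powr_right)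
  then show "integrable (lebesgue_on {t..T}) (majorant t)" unfolding majorant_def by simp
  have "(\<integral>r. majorant t r \<partial>lebesgue_on {t..T}) = 6 * (T - t) powr (1 - \<gamma>) / (1 - \<gamma>)"
    using i exponents t by (simp add: majorant_def integral_powr_left integral_powr_right)
  also have "\<dots> \<le> 6 * T powr (1 - \<gamma>) / (1 - \<gamma>)"
    using exponents t by (intro divide_right_mono mult_left_mono powr_mono2) auto
  finally show "\<beta> powr (- \<epsilon>) * (\<integral>r. majorant t r \<partial>lebesgue_on {t..T}) \<le> \<kappa> \<beta>"
    unfolding \<kappa>_def by (rule mult_left_mono) simp
qed

text \<open>The product \<open>(T - r)\<^sup>-\<^sup>2\<^sup>\<alpha> (r - t)\<^sup>-\<^sup>2\<^sup>\<alpha>\<close> costs one factor \<open>(T - t)\<^sup>-\<^sup>2\<^sup>\<alpha>\<close>, and trading part of the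
  decay of \<open>exp (- \<beta> (r - t))\<close> for a slightly worse singularity gains the small factor
  \<open>\<beta>\<^sup>-\<^sup>\<epsilon>\<close>.\<close>

lemma kernel_bound:
  assumes r: "t < r" "r < T" and \<beta>: "\<beta> > 0"
  shows "weight \<beta> r * ((r - t) powr (- 2 * \<alpha>) + (T - t) powr (- 2 * \<alpha>))
           \<le> weight \<beta> t * (\<beta> powr (- \<epsilon>) * majorant t r)"
    and "weight \<beta> r \<le> weight \<beta> t * (T - t) powr (2 * \<alpha>) * (\<beta> powr (- \<epsilon>) * majorant t r)"
proof -
  define u v where "u = r - t" and "v = T - r"
  have uv: "u > 0" "v > 0" "T - t = u + v" using r by (auto simp: u_def v_def)
  define E B where "E = exp (\<beta> * (T - t))" and "B = \<beta> powr (- \<epsilon>)"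
  have EB: "E > 0" "B \<ge> 0" by (auto simp: E_def B_def)
  define m where "m = u powr (- \<gamma>) + v powr (- \<gamma>)"
  have "exp (- (\<beta> * u)) \<le> (\<beta> * u) powr (- \<epsilon>)"
    using uv \<beta> exponents by (intro exp_minus_le_powr) auto
  also have "\<dots> = B * u powr (- \<epsilon>)" using uv \<beta> by (simp add: B_def powr_mult)
  finally have "E * exp (- (\<beta> * u)) \<le> E * (B * u powr (- \<epsilon>))" using EB by simp
  moreover have "exp (\<beta> * v) = E * exp (- (\<beta> * u))"
    using uv by (simp add: E_def exp_add[symmetric] algebra_simps)
  ultimately have ex: "exp (\<beta> * v) \<le> E * (B * u powr (- \<epsilon>))" by simp
  \<comment> \<open>The exponents 2\<alpha> and \<epsilon> add up to \<gamma>, so mixed products of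
    the two singularities are dominated by m.\<close>
  have vu: "v powr (- (2 * \<alpha>)) * u powr (- \<epsilon>) \<le> m"
    using powr_minus_mult_le[of v u "2 * \<alpha>" \<epsilon>] uv \<alpha> exponents by (simp add: m_def)
  have uu: "u powr (- (2 * \<alpha>)) * u powr (- \<epsilon>) = u powr (- \<gamma>)"
  proof -
    have "- (2 * \<alpha>) + - \<epsilon> = - \<gamma>" using exponents(5) by linarith
    then show ?thesis unfolding powr_add[symmetric] by (simp only:)
  qed
  have w: "weight \<beta> r \<le> v powr (- (2 * \<alpha>)) * (E * (B * u powr (- \<epsilon>)))"
    unfolding weight_def v_def[symmetric] using ex by (simp add: mult_left_mono)
  have w2: "weight \<beta> r \<le> E * B * m"
  proof -
    note w
    also have "v powr (- (2 * \<alpha>)) * (E * (B * u powr (- \<epsilon>)))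
        = E * B * (v powr (- (2 * \<alpha>)) * u powr (- \<epsilon>))" by (simp add: mult_ac)
    also have "\<dots> \<le> E * B * m" using vu EB by (intro mult_left_mono) auto
    finally show ?thesis .
  qed
  have wt: "weight \<beta> t = (u + v) powr (- (2 * \<alpha>)) * E" by (simp add: weight_def E_def uv(3))
  have maj: "majorant t r = 3 * m" by (simp add: majorant_def m_def u_def v_def)
  have m0: "m \<ge> 0" by (simp add: m_def)
  have "weight \<beta> r * u powr (- (2 * \<alpha>))
      \<le> v powr (- (2 * \<alpha>)) * (E * (B * u powr (- \<epsilon>))) * u powr (- (2 * \<alpha>))"
    using w by (intro mult_right_mono) auto
  also have "\<dots> = E * B * u powr (- \<epsilon>) * (u powr (- (2 * \<alpha>)) * v powr (- (2 * \<alpha>)))"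
    by (simp add: mult_ac)
  also have "\<dots> \<le> E * B * u powr (- \<epsilon>)
      * ((u + v) powr (- (2 * \<alpha>)) * (u powr (- (2 * \<alpha>)) + v powr (- (2 * \<alpha>))))"
    using uv EB \<alpha> exponents by (intro mult_left_mono powr_product_le) auto
  also have "\<dots> = weight \<beta> t * B
      * (u powr (- (2 * \<alpha>)) * u powr (- \<epsilon>) + v powr (- (2 * \<alpha>)) * u powr (- \<epsilon>))"
    by (simp add: wt algebra_simps)
  also have "\<dots> \<le> weight \<beta> t * B * (m + m)"
    using vu EB weight_pos[of t \<beta>] r unfolding uu
    by (intro mult_left_mono add_mono) (auto simp: m_def)
  finally have 1: "weight \<beta> r * u powr (- (2 * \<alpha>)) \<le> weight \<beta> t * B * (2 * m)" by simp
  have "weight \<beta> r * (u + v) powr (- (2 * \<alpha>)) \<le> E * B * m * (u + v) powr (- (2 * \<alpha>))"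
    using w2 by (intro mult_right_mono) auto
  then have 2: "weight \<beta> r * (u + v) powr (- (2 * \<alpha>)) \<le> weight \<beta> t * B * m"
    by (simp add: wt mult_ac)
  show "weight \<beta> r * ((r - t) powr (- 2 * \<alpha>) + (T - t) powr (- 2 * \<alpha>))
           \<le> weight \<beta> t * (\<beta> powr (- \<epsilon>) * majorant t r)"
    using 1 2 by (simp add: uv(3) u_def[symmetric] B_def[symmetric] maj algebra_simps)
  \<comment> \<open>Without the smoothing term no factor (T - t)^(-2\<alpha>) arises, so the one
    inside \<open>weight \<beta> t\<close> is cancelled; the factor 3 of the majorant is slack
    here.\<close>
  have "(u + v) powr (- (2 * \<alpha>)) * (u + v) powr (2 * \<alpha>) = 1"
    using uv by (simp add: powr_add[symmetric])
  then have "weight \<beta> t * (T - t) powr (2 * \<alpha>) = E" by (simp add: wt uv(3) mult_ac)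
  moreover have "E * B * m \<le> E * (B * (3 * m))"
    using EB m0 unfolding mult.assoc by (intro mult_left_mono) auto
  ultimately show "weight \<beta> r \<le> weight \<beta> t * (T - t) powr (2 * \<alpha>) * (\<beta> powr (- \<epsilon>) * majorant t r)"
    unfolding B_def[symmetric] maj using w2 by (simp only:)
qed

text \<open>Common source of the two bounds that follow: a single vector gives the norm of
  \<open>evolve L t\<close>, and the family C_i x gives the partial sums of the series. Keeping I
  finite in use makes the exchange of sum and integral plain linearity.\<close>

lemma evolve_sum_bound:
  assumes L: "admissible L" and Lm: "\<And>s. s \<in> {0..<T} \<Longrightarrow> norm (L s) \<le> m * weight \<beta> s"
    and m: "m \<ge> 0" and \<beta>: "\<beta> > 0" and t: "t \<in> {0..<T}" and k: "k \<ge> 0"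
    and z: "\<And>r. t < r \<Longrightarrow> r < T \<Longrightarrow>
        m * weight \<beta> r * (\<Sum>i\<in>I. (norm (S (r - t) (z i)))\<^sup>2) \<le> k * (\<beta> powr (- \<epsilon>) * majorant t r)"
  shows "(\<Sum>i\<in>I. \<bar>evolve L t (z i) \<bullet> z i\<bar>) \<le> k * \<kappa> \<beta>"
proof -
  have t': "t \<in> {0..T}" using t by auto
  let ?\<mu> = "lebesgue_on {t..T}"
  let ?q = "\<lambda>i r. L r (S (r - t) (z i)) \<bullet> S (r - t) (z i)"
  note int = quadratic_integrable[OF L t']
  have "(\<Sum>i\<in>I. \<bar>evolve L t (z i) \<bullet> z i\<bar>) \<le> (\<Sum>i\<in>I. \<integral>r. \<bar>?q i r\<bar> \<partial>?\<mu>)"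
    unfolding evolve_inner[OF L t'] by (intro sum_mono integral_abs_bound)
  also have "\<dots> = (\<integral>r. (\<Sum>i\<in>I. \<bar>?q i r\<bar>) \<partial>?\<mu>)"
    by (rule Bochner_Integration.integral_sum[symmetric]) (intro integrable_abs int)
  also have "\<dots> \<le> (\<integral>r. k * (\<beta> powr (- \<epsilon>) * majorant t r) \<partial>?\<mu>)"
  proof (rule integral_mono_AE)
    show "integrable ?\<mu> (\<lambda>r. \<Sum>i\<in>I. \<bar>?q i r\<bar>)"
      by (intro Bochner_Integration.integrable_sum integrable_abs int)
    show "integrable ?\<mu> (\<lambda>r. k * (\<beta> powr (- \<epsilon>) * majorant t r))"
      by (intro integrable_mult_right majorant_integral(1) t)
    have "0 \<le> t" using t by simp
    from AE_ivl'[OF this] show "AE r in ?\<mu>. (\<Sum>i\<in>I. \<bar>?q i r\<bar>) \<le> k * (\<beta> powr (- \<epsilon>) * majorant t r)"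
    proof eventually_elim
      case (elim r)
      have "(\<Sum>i\<in>I. \<bar>?q i r\<bar>) \<le> (\<Sum>i\<in>I. m * weight \<beta> r * (norm (S (r - t) (z i)))\<^sup>2)"
        using elim t by (intro sum_mono order_trans[OF abs_quadratic_le] mult_right_mono Lm) auto
      also have "\<dots> \<le> k * (\<beta> powr (- \<epsilon>) * majorant t r)"
        using z elim by (simp add: sum_distrib_left)
      finally show ?case .
    qed
  qed
  also have "\<dots> = k * (\<beta> powr (- \<epsilon>) * (\<integral>r. majorant t r \<partial>?\<mu>))" by simp
  also have "\<dots> \<le> k * \<kappa> \<beta>" by (intro mult_left_mono majorant_integral t k)
  finally show ?thesis .
qed

text \<open>The factor (T - t)^(2\<alpha>) removes the singularity of the weight and leaves room for
  the (T - t)^(-\<alpha>) of \<open>A0\<close>. The index set {0} turns the family estimate into one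
  for a single x.\<close>

lemma norm_evolve_le:
  assumes L: "admissible L" and Lm: "\<And>s. s \<in> {0..<T} \<Longrightarrow> norm (L s) \<le> m * weight \<beta> s"
    and m: "m \<ge> 0" and \<beta>: "\<beta> > 0" and t: "t \<in> {0..<T}"
  shows "norm (evolve L t) \<le> m * M\<^sup>2 * (T - t) powr (2 * \<alpha>) * \<kappa> \<beta> * weight \<beta> t"
proof (rule self_adjoint_norm_le)
  have w: "weight \<beta> t \<ge> 0" using weight_pos[of t \<beta>] t by auto
  show "self_adjoint (evolve L t)" using L t by (intro evolve_self_adjoint) auto
  show "0 \<le> m * M\<^sup>2 * (T - t) powr (2 * \<alpha>) * \<kappa> \<beta> * weight \<beta> t"
    using m w \<kappa>_nonneg by simp
  fix x :: 'h
  define k where "k = m * M\<^sup>2 * (norm x)\<^sup>2 * (weight \<beta> t * (T - t) powr (2 * \<alpha>))"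
  have "(\<Sum>i\<in>{0::nat}. \<bar>evolve L t x \<bullet> x\<bar>) \<le> k * \<kappa> \<beta>"
  proof (rule evolve_sum_bound[OF L Lm m \<beta> t])
    show "0 \<le> k" using m w by (simp add: k_def)
    fix r assume r: "t < r" "r < T"
    have "norm (S (r - t) x) \<le> M * norm x" using r t by (intro norm_S_le) auto
    then have "(norm (S (r - t) x))\<^sup>2 \<le> (M * norm x)\<^sup>2" by (intro power_mono) auto
    moreover note kernel_bound(2)[OF r \<beta>]
    ultimately have "weight \<beta> r * (norm (S (r - t) x))\<^sup>2
        \<le> (weight \<beta> t * (T - t) powr (2 * \<alpha>) * (\<beta> powr (- \<epsilon>) * majorant t r)) * (M * norm x)\<^sup>2"
      using weight_pos[OF r(2), of \<beta>] by (intro mult_mono) auto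
    then have "m * (weight \<beta> r * (norm (S (r - t) x))\<^sup>2)
        \<le> m * ((weight \<beta> t * (T - t) powr (2 * \<alpha>) * (\<beta> powr (- \<epsilon>) * majorant t r)) * (M * norm x)\<^sup>2)"
      using m by (rule mult_left_mono)
    then show "m * weight \<beta> r * (\<Sum>i\<in>{0::nat}. (norm (S (r - t) x))\<^sup>2)
        \<le> k * (\<beta> powr (- \<epsilon>) * majorant t r)"
      by (simp add: k_def power_mult_distrib mult_ac)
  qed auto
  then show "\<bar>evolve L t x \<bullet> x\<bar>
      \<le> m * M\<^sup>2 * (T - t) powr (2 * \<alpha>) * \<kappa> \<beta> * weight \<beta> t * (norm x)\<^sup>2"
    by (simp add: k_def mult_ac)
qed

text \<open>The smoothing hypothesis is used at time gap r - t with coefficient time t. The bound on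
  partial sums is uniform in n, which yields summability and the bound of the series
  together.\<close>

lemma evolve_sandwich:
  assumes L: "admissible L" and Lm: "\<And>s. s \<in> {0..<T} \<Longrightarrow> norm (L s) \<le> m * weight \<beta> s"
    and m: "m \<ge> 0" and \<beta>: "\<beta> > 0" and t: "t \<in> {0..<T}"
  shows "summable (\<lambda>i. \<bar>(adj (C i t) o\<^sub>L evolve L t o\<^sub>L C i t) x \<bullet> x\<bar>)"
    and "(\<Sum>i. \<bar>(adj (C i t) o\<^sub>L evolve L t o\<^sub>L C i t) x \<bullet> x\<bar>) \<le> m * c * \<kappa> \<beta> * weight \<beta> t * (norm x)\<^sup>2"
proof -
  have w: "weight \<beta> t \<ge> 0" using weight_pos[of t \<beta>] t by auto
  define k where "k = m * c * (norm x)\<^sup>2 * weight \<beta> t"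
  have fin: "(\<Sum>i<n. \<bar>evolve L t (C i t x) \<bullet> C i t x\<bar>) \<le> k * \<kappa> \<beta>" for n
  proof (rule evolve_sum_bound[OF L Lm m \<beta> t])
    show "0 \<le> k" using m w c by (simp add: k_def)
    fix r assume r: "t < r" "r < T"
    define R where "R = (r - t) powr (- 2 * \<alpha>) + (T - t) powr (- 2 * \<alpha>)"
    have "(\<Sum>i<n. (norm (S (r - t) (C i t x)))\<^sup>2) \<le> (\<Sum>i. (norm (S (r - t) (C i t x)))\<^sup>2)"
      using r t by (intro sum_le_suminf C_summable) auto
    also have "\<dots> \<le> c * R * (norm x)\<^sup>2" unfolding R_def using r t by (intro C_bound) auto
    finally have "m * weight \<beta> r * (\<Sum>i<n. (norm (S (r - t) (C i t x)))\<^sup>2)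
        \<le> m * weight \<beta> r * (c * R * (norm x)\<^sup>2)"
      using m weight_pos[OF r(2), of \<beta>] by (intro mult_left_mono) auto
    also have "\<dots> = m * c * (norm x)\<^sup>2 * (weight \<beta> r * R)" by (simp add: mult_ac)
    also have "\<dots> \<le> m * c * (norm x)\<^sup>2 * (weight \<beta> t * (\<beta> powr (- \<epsilon>) * majorant t r))"
      unfolding R_def using m c by (intro mult_left_mono kernel_bound(1) r \<beta>) auto
    finally show "m * weight \<beta> r * (\<Sum>i<n. (norm (S (r - t) (C i t x)))\<^sup>2)
        \<le> k * (\<beta> powr (- \<epsilon>) * majorant t r)"
      by (simp add: k_def mult_ac)
  qed auto
  have eq: "(adj (C i t) o\<^sub>L evolve L t o\<^sub>L C i t) x \<bullet> x = evolve L t (C i t x) \<bullet> C i t x" for i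
    by (simp add: adj_inner)
  show s: "summable (\<lambda>i. \<bar>(adj (C i t) o\<^sub>L evolve L t o\<^sub>L C i t) x \<bullet> x\<bar>)"
    unfolding eq by (rule summableI_nonneg_bounded[OF _ fin]) auto
  show "(\<Sum>i. \<bar>(adj (C i t) o\<^sub>L evolve L t o\<^sub>L C i t) x \<bullet> x\<bar>) \<le> m * c * \<kappa> \<beta> * weight \<beta> t * (norm x)\<^sup>2"
    using s fin unfolding eq by (intro order_trans[OF suminf_le_const]) (auto simp: k_def mult_ac)
qed


section \<open>The uniqueness class and the brackets of its members\<close>

definition tame :: "(real \<Rightarrow> 'h \<Rightarrow>\<^sub>L 'h) \<Rightarrow> bool" where
  "tame P \<longleftrightarrow> P \<in> Cs_self_adjoint T \<and> (\<exists>K>0. sandwich_estimate T \<alpha> C P K)"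

lemma tameI:
  assumes "\<And>t. t \<in> {0..T} \<Longrightarrow> self_adjoint (P t)" "\<And>x. continuous_on {0..T} (\<lambda>t. P t x)"
    and "\<And>t x. t \<in> {0..<T} \<Longrightarrow> summable (\<lambda>i. \<bar>(adj (C i t) o\<^sub>L P t o\<^sub>L C i t) x \<bullet> x\<bar>)"
    and "\<And>t x. t \<in> {0..<T} \<Longrightarrow> (\<Sum>i. \<bar>(adj (C i t) o\<^sub>L P t o\<^sub>L C i t) x \<bullet> x\<bar>)
           \<le> K * (T - t) powr (- 2 * \<alpha>) * (norm x)\<^sup>2"
  shows "tame P"
proof -
  \<comment> \<open>A strictly positive constant is required, while K is arbitrary.\<close>
  have "sandwich_estimate T \<alpha> C P (\<bar>K\<bar> + 1)"
    unfolding sandwich_estimate_def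
  proof (intro ballI allI conjI)
    fix s x assume s: "s \<in> {0..<T}"
    show "summable (\<lambda>i. \<bar>(adj (C i s) o\<^sub>L P s o\<^sub>L C i s) x \<bullet> x\<bar>)" by (rule assms(3)[OF s])
    have "(\<Sum>i. \<bar>(adj (C i s) o\<^sub>L P s o\<^sub>L C i s) x \<bullet> x\<bar>) \<le> K * (T - s) powr (- 2 * \<alpha>) * (norm x)\<^sup>2"
      by (rule assms(4)[OF s])
    also have "\<dots> \<le> (\<bar>K\<bar> + 1) * (T - s) powr (- 2 * \<alpha>) * (norm x)\<^sup>2"
      by (intro mult_right_mono) auto
    finally show "(\<Sum>i. \<bar>(adj (C i s) o\<^sub>L P s o\<^sub>L C i s) x \<bullet> x\<bar>)
        \<le> (\<bar>K\<bar> + 1) * (T - s) powr (- 2 * \<alpha>) * (norm x)\<^sup>2" .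
  qed
  moreover have "\<bar>K\<bar> + 1 > 0" by simp
  ultimately show ?thesis using assms(1,2) unfolding tame_def Cs_self_adjoint_def by blast
qed

lemma tameD:
  assumes "tame P"
  shows "t \<in> {0..T} \<Longrightarrow> self_adjoint (P t)" and "continuous_on {0..T} (\<lambda>t. P t x)"
    and "t \<in> {0..<T} \<Longrightarrow> summable (\<lambda>i. \<bar>(adj (C i t) o\<^sub>L P t o\<^sub>L C i t) x \<bullet> x\<bar>)"
proof -
  obtain K where K: "sandwich_estimate T \<alpha> C P K" using assms unfolding tame_def by blast
  show "t \<in> {0..T} \<Longrightarrow> self_adjoint (P t)" "continuous_on {0..T} (\<lambda>t. P t x)"
    using assms unfolding tame_def Cs_self_adjoint_def by blast+
  show "t \<in> {0..<T} \<Longrightarrow> summable (\<lambda>i. \<bar>(adj (C i t) o\<^sub>L P t o\<^sub>L C i t) x \<bullet> x\<bar>)"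
    using K unfolding sandwich_estimate_def by blast
qed

lemma tame_sandwich_bound:
  assumes "tame P"
  shows "\<exists>K>0. \<forall>t\<in>{0..<T}. \<forall>x. (\<Sum>i. \<bar>(adj (C i t) o\<^sub>L P t o\<^sub>L C i t) x \<bullet> x\<bar>)
           \<le> K * (T - t) powr (- 2 * \<alpha>) * (norm x)\<^sup>2"
proof -
  obtain K where K: "K > 0" "sandwich_estimate T \<alpha> C P K" using assms unfolding tame_def by blast
  show ?thesis
    using K(2) unfolding sandwich_estimate_def by (intro exI[of _ K] conjI K(1)) blast
qed

lemma tame_sandwich_sum:
  assumes P: "tame P" and t: "t \<in> {0..<T}"
  shows "self_adjoint (sandwich_sum (\<lambda>i. C i t) (P t))"
    and "(\<lambda>i. (adj (C i t) o\<^sub>L P t o\<^sub>L C i t) x \<bullet> x) sums (sandwich_sum (\<lambda>i. C i t) (P t) x \<bullet> x)"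
proof -
  obtain K where K: "K > 0" "\<And>t x. t \<in> {0..<T} \<Longrightarrow>
    (\<Sum>i. \<bar>(adj (C i t) o\<^sub>L P t o\<^sub>L C i t) x \<bullet> x\<bar>) \<le> K * (T - t) powr (- 2 * \<alpha>) * (norm x)\<^sup>2"
    using tame_sandwich_bound[OF P] by blast
  have "self_adjoint (P t)" using P t by (intro tameD) auto
  note * = this tameD(3)[OF P t] K(2)[OF t]
  have "0 \<le> K * (T - t) powr (- 2 * \<alpha>)" using K(1) by simp
  from self_adjoint_sandwich_sum[OF * this] sums_sandwich_sum[OF * this]
  show "self_adjoint (sandwich_sum (\<lambda>i. C i t) (P t))"
    "(\<lambda>i. (adj (C i t) o\<^sub>L P t o\<^sub>L C i t) x \<bullet> x) sums (sandwich_sum (\<lambda>i. C i t) (P t) x \<bullet> x)"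
    by blast+
qed

lemma tame_add:
  assumes P: "tame P" and Q: "tame Q"
  shows "tame (\<lambda>t. P t + Q t)"
proof -
  obtain K where K: "K > 0" "\<And>t x. t \<in> {0..<T} \<Longrightarrow>
    (\<Sum>i. \<bar>(adj (C i t) o\<^sub>L P t o\<^sub>L C i t) x \<bullet> x\<bar>) \<le> K * (T - t) powr (- 2 * \<alpha>) * (norm x)\<^sup>2"
    using tame_sandwich_bound[OF P] by blast
  obtain K' where K': "K' > 0" "\<And>t x. t \<in> {0..<T} \<Longrightarrow>
    (\<Sum>i. \<bar>(adj (C i t) o\<^sub>L Q t o\<^sub>L C i t) x \<bullet> x\<bar>) \<le> K' * (T - t) powr (- 2 * \<alpha>) * (norm x)\<^sup>2"
    using tame_sandwich_bound[OF Q] by blast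
  show ?thesis
  proof (rule tameI[where K = "K + K'"])
    fix t x assume t: "t \<in> {0..<T}"
    let ?p = "\<lambda>i. \<bar>(adj (C i t) o\<^sub>L P t o\<^sub>L C i t) x \<bullet> x\<bar>" and ?q = "\<lambda>i. \<bar>(adj (C i t) o\<^sub>L Q t o\<^sub>L C i t) x \<bullet> x\<bar>"
    let ?s = "\<lambda>i. \<bar>(adj (C i t) o\<^sub>L (P t + Q t) o\<^sub>L C i t) x \<bullet> x\<bar>"
    have sm: "summable (\<lambda>i. ?p i + ?q i)"
      by (intro summable_add tameD(3)[OF P t] tameD(3)[OF Q t])
    have le: "?s i \<le> ?p i + ?q i" for i
      by (simp add: blinfun.add_left blinfun.add_right inner_add_left abs_triangle_ineq)
    show sm': "summable ?s" by (rule summable_comparison_test'[OF sm, of 0]) (use le in simp)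
    have "(\<Sum>i. ?s i) \<le> (\<Sum>i. ?p i + ?q i)" by (intro suminf_le le sm sm')
    also have "\<dots> = (\<Sum>i. ?p i) + (\<Sum>i. ?q i)"
      by (rule suminf_add[symmetric]) (intro tameD(3)[OF P t] tameD(3)[OF Q t])+
    also have "\<dots> \<le> (K + K') * (T - t) powr (- 2 * \<alpha>) * (norm x)\<^sup>2"
      using K(2)[OF t, of x] K'(2)[OF t, of x] by (simp add: distrib_right)
    finally show "(\<Sum>i. ?s i) \<le> (K + K') * (T - t) powr (- 2 * \<alpha>) * (norm x)\<^sup>2" .
  next
    show "continuous_on {0..T} (\<lambda>t. (P t + Q t) x)" for x
      unfolding blinfun.add_left by (intro continuous_intros tameD P Q)
  qed (intro self_adjoint_add tameD P Q)
qed

lemma norm_lyap_term_le: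
  assumes P: "tame P" and t: "t \<in> {0..<T}" and p: "norm (P t) \<le> p" and q: "0 \<le> q"
    and sum: "\<And>x. (\<Sum>i. \<bar>(adj (C i t) o\<^sub>L P t o\<^sub>L C i t) x \<bullet> x\<bar>) \<le> q * (norm x)\<^sup>2"
  shows "norm (lyap_term A0 C P t) \<le> 2 * c * (T - t) powr (- \<alpha>) * p + q"
proof -
  have p0: "0 \<le> p" using p norm_ge_zero order_trans by blast
  have "norm (adj (A0 t) o\<^sub>L P t) \<le> norm (adj (A0 t)) * norm (P t)" by (rule norm_blinfun_compose)
  also have "\<dots> \<le> (c * (T - t) powr (- \<alpha>)) * p"
    using A0_bound[OF t] p c by (intro mult_mono order_trans[OF norm_adj_le]) auto
  finally have 1: "norm (adj (A0 t) o\<^sub>L P t) \<le> (c * (T - t) powr (- \<alpha>)) * p" .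
  have "norm (P t o\<^sub>L A0 t) \<le> norm (P t) * norm (A0 t)" by (rule norm_blinfun_compose)
  also have "\<dots> \<le> p * (c * (T - t) powr (- \<alpha>))"
    using A0_bound[OF t] p p0 by (intro mult_mono) auto
  finally have 2: "norm (P t o\<^sub>L A0 t) \<le> (c * (T - t) powr (- \<alpha>)) * p" by (simp add: mult.commute)
  have sa: "self_adjoint (P t)" using P t by (intro tameD) auto
  have 3: "norm (sandwich_sum (\<lambda>i. C i t) (P t)) \<le> q"
    by (rule norm_sandwich_sum_le[OF sa tameD(3)[OF P t] sum q])
  have "norm (lyap_term A0 C P t)
      \<le> norm (adj (A0 t) o\<^sub>L P t) + norm (P t o\<^sub>L A0 t) + norm (sandwich_sum (\<lambda>i. C i t) (P t))"
    unfolding lyap_term_def by (intro norm_triangle_le add_right_mono norm_triangle_ineq)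
  then show ?thesis using 1 2 3 by simp
qed

text \<open>\<open>sandwich_sum\<close> is a definite description, so its additivity comes from
  uniqueness: the difference of the two sums has the right quadratic form.\<close>

lemma lyap_term_diff:
  assumes P: "tame P" and Q: "tame Q" and t: "t \<in> {0..<T}"
  shows "lyap_term A0 C (\<lambda>t. P t - Q t) t = lyap_term A0 C P t - lyap_term A0 C Q t"
proof -
  have "sandwich_sum (\<lambda>i. C i t) (P t - Q t)
      = sandwich_sum (\<lambda>i. C i t) (P t) - sandwich_sum (\<lambda>i. C i t) (Q t)"
  proof (rule sandwich_sum_eqI)
    fix x
    show "(\<lambda>i. (adj (C i t) o\<^sub>L (P t - Q t) o\<^sub>L C i t) x \<bullet> x) sums
        ((sandwich_sum (\<lambda>i. C i t) (P t) - sandwich_sum (\<lambda>i. C i t) (Q t)) x \<bullet> x)"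
      using sums_diff[OF tame_sandwich_sum(2)[OF P t, of x] tame_sandwich_sum(2)[OF Q t, of x]]
      by (simp add: blinfun.diff_left blinfun.diff_right inner_diff_left)
  qed (intro self_adjoint_diff tame_sandwich_sum P Q t)
  moreover have "(adj (A0 t) o\<^sub>L (P t - Q t)) = (adj (A0 t) o\<^sub>L P t) - (adj (A0 t) o\<^sub>L Q t)"
    "((P t - Q t) o\<^sub>L A0 t) = (P t o\<^sub>L A0 t) - (Q t o\<^sub>L A0 t)"
    by (rule blinfun_eqI, simp add: blinfun.diff_left blinfun.diff_right)+
  ultimately show ?thesis unfolding lyap_term_def by simp
qed

lemma lyap_term_self_adjoint:
  assumes P: "tame P" and t: "t \<in> {0..<T}"
  shows "self_adjoint (lyap_term A0 C P t)"
proof -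
  have "self_adjoint (P t)" using P t by (intro tameD) auto
  then have "self_adjoint ((adj (A0 t) o\<^sub>L P t) + (P t o\<^sub>L A0 t))"
    by (simp add: self_adjoint_def blinfun.add_left inner_add_left inner_add_right adj_inner adj_inner')
  then show ?thesis
    unfolding lyap_term_def by (rule self_adjoint_add) (rule tame_sandwich_sum(1)[OF P t])
qed

text \<open>The sandwich sum has measurable quadratic forms, as pointwise sums of series;
  polarization gives weak and Pettis strong measurability. In the first term \<open>A0\<close> is
  moved to the test vector y, so its adjoint needs no measurability.\<close>

lemma lyap_term_measurable:
  assumes P: "tame P"
  shows "(\<lambda>s. lyap_term A0 C P s x) \<in> borel_measurable (lebesgue_on {0<..<T})"
proof (rule borel_measurable_weakI)
  fix y
  let ?\<mu> = "lebesgue_on {0<..<T}"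
  have Pm: "(\<lambda>s. P s z) \<in> borel_measurable ?\<mu>" for z
    by (intro continuous_imp_measurable_on_sets_lebesgue continuous_on_subset[OF tameD(2)[OF P]]) auto
  note Pu = borel_measurable_blinfun_apply_pw[OF Pm]
  define K where "K = (\<lambda>s. sandwich_sum (\<lambda>i. C i s) (P s))"
  have q: "(\<lambda>s. K s z \<bullet> z) \<in> borel_measurable ?\<mu>" for z
  proof -
    have 1: "(\<lambda>s. \<Sum>i. P s (C i s z) \<bullet> C i s z) \<in> borel_measurable ?\<mu>"
      by (intro borel_measurable_suminf borel_measurable_inner Pu C_measurable)
    have 2: "(\<Sum>i. P s (C i s z) \<bullet> C i s z) = K s z \<bullet> z" if "s \<in> space ?\<mu>" for s
      using tame_sandwich_sum(2)[OF P, of s z] that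
      by (simp add: K_def adj_inner sums_unique[symmetric])
    show ?thesis by (rule measurable_cong[THEN iffD1, OF 2 1])
  qed
  have 1: "(\<lambda>s. (K s (x + y) \<bullet> (x + y) - K s (x - y) \<bullet> (x - y)) / 4) \<in> borel_measurable ?\<mu>"
    by (intro borel_measurable_divide borel_measurable_diff q) auto
  have 2: "(K s (x + y) \<bullet> (x + y) - K s (x - y) \<bullet> (x - y)) / 4 = K s x \<bullet> y"
    if "s \<in> space ?\<mu>" for s
    using that unfolding K_def by (intro polarization[symmetric] tame_sandwich_sum P) auto
  have "(\<lambda>s. K s x \<bullet> y) \<in> borel_measurable ?\<mu>"
    by (rule measurable_cong[THEN iffD1, OF 2 1])
  moreover have "(\<lambda>s. P s x \<bullet> A0 s y) \<in> borel_measurable ?\<mu>"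
    by (intro borel_measurable_inner Pm A0_measurable)
  moreover have "(\<lambda>s. P s (A0 s x) \<bullet> y) \<in> borel_measurable ?\<mu>"
    by (intro borel_measurable_inner Pu A0_measurable) auto
  ultimately show "(\<lambda>s. lyap_term A0 C P s x \<bullet> y) \<in> borel_measurable ?\<mu>"
    unfolding lyap_term_def K_def
    by (simp add: blinfun.add_left inner_add_left adj_inner)
qed

lemma lyap_term_admissible:
  assumes P: "tame P"
  shows "admissible (lyap_term A0 C P)"
  unfolding admissible_def
proof (intro conjI allI)
  show "(\<lambda>s. lyap_term A0 C P s x) \<in> borel_measurable (lebesgue_on {0<..<T})" for x
    by (rule lyap_term_measurable[OF P])
  show "AE s in lebesgue_on {0<..<T}. self_adjoint (lyap_term A0 C P s)"
    by (rule AE_I2) (auto intro: lyap_term_self_adjoint[OF P])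
  obtain N where N: "N > 0" "\<And>t. t \<in> {0..T} \<Longrightarrow> norm (P t) \<le> N"
    using strongly_continuous_bounded[of "{0..T}" P] tameD(2)[OF P] by auto
  obtain K where K: "K > 0" "\<And>t x. t \<in> {0..<T} \<Longrightarrow>
    (\<Sum>i. \<bar>(adj (C i t) o\<^sub>L P t o\<^sub>L C i t) x \<bullet> x\<bar>) \<le> K * (T - t) powr (- 2 * \<alpha>) * (norm x)\<^sup>2"
    using tame_sandwich_bound[OF P] by blast
  show "\<exists>k\<ge>0. \<forall>s\<in>{0..<T}. norm (lyap_term A0 C P s) \<le> k * (T - s) powr (- 2 * \<alpha>)"
  proof (intro exI[of _ "2 * c * T powr \<alpha> * N + K"] conjI ballI)
    fix s assume s: "s \<in> {0..<T}"
    have "norm (lyap_term A0 C P s) \<le> 2 * c * (T - s) powr (- \<alpha>) * N + K * (T - s) powr (- 2 * \<alpha>)"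
      using s N K by (intro norm_lyap_term_le[OF P s]) auto
    \<comment> \<open>The milder singularity of the \<open>A0\<close> terms is absorbed into the
      exponent 2\<alpha> at the cost of T^\<alpha>.\<close>
    also have "(T - s) powr (- \<alpha>) = (T - s) powr \<alpha> * (T - s) powr (- 2 * \<alpha>)"
      using s by (simp add: powr_add[symmetric])
    also have "2 * c * ((T - s) powr \<alpha> * (T - s) powr (- 2 * \<alpha>)) * N
        \<le> 2 * c * (T powr \<alpha> * (T - s) powr (- 2 * \<alpha>)) * N"
      using s c N \<alpha> by (intro mult_right_mono mult_left_mono powr_mono2) auto
    finally show "norm (lyap_term A0 C P s) \<le> (2 * c * T powr \<alpha> * N + K) * (T - s) powr (- 2 * \<alpha>)"
      by (simp add: algebra_simps)
  qed (use c N K in simp)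
qed

lemma admissible_diff:
  assumes "admissible L" "admissible L'"
  shows "admissible (\<lambda>s. L s - L' s)"
proof -
  obtain k where k: "k \<ge> 0" "\<And>s. s \<in> {0..<T} \<Longrightarrow> norm (L s) \<le> k * (T - s) powr (- 2 * \<alpha>)"
    using assms(1) unfolding admissible_def by blast
  obtain k' where k': "k' \<ge> 0" "\<And>s. s \<in> {0..<T} \<Longrightarrow> norm (L' s) \<le> k' * (T - s) powr (- 2 * \<alpha>)"
    using assms(2) unfolding admissible_def by blast
  show ?thesis
    unfolding admissible_def
  proof (intro conjI allI exI[of _ "k + k'"] ballI)
    show "(\<lambda>s. (L s - L' s) x) \<in> borel_measurable (lebesgue_on {0<..<T})" for x
      using assms unfolding blinfun.diff_left admissible_def by (intro borel_measurable_diff) auto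
    have "AE s in lebesgue_on {0<..<T}. self_adjoint (L s)" "AE s in lebesgue_on {0<..<T}. self_adjoint (L' s)"
      using assms by (auto simp: admissible_def)
    then show "AE s in lebesgue_on {0<..<T}. self_adjoint (L s - L' s)"
      by eventually_elim (rule self_adjoint_diff)
    show "norm (L s - L' s) \<le> (k + k') * (T - s) powr (- 2 * \<alpha>)" if "s \<in> {0..<T}" for s
      using norm_triangle_ineq4[of "L s" "L' s"] k(2)[OF that] k'(2)[OF that]
      by (simp add: distrib_right)
  qed (use k k' in simp)
qed

lemma admissible_weight_bound:
  assumes "admissible L" "\<beta> > 0"
  obtains m where "m \<ge> 0" "\<And>s. s \<in> {0..<T} \<Longrightarrow> norm (L s) \<le> m * weight \<beta> s"
proof -
  obtain k where k: "k \<ge> 0" "\<And>s. s \<in> {0..<T} \<Longrightarrow> norm (L s) \<le> k * (T - s) powr (- 2 * \<alpha>)"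
    using assms(1) unfolding admissible_def by blast
  have "norm (L s) \<le> k * weight \<beta> s" if s: "s \<in> {0..<T}" for s
  proof -
    have "k * (T - s) powr (- 2 * \<alpha>) \<le> k * weight \<beta> s"
      using k(1) s assms by (intro mult_left_mono weight_ge) auto
    with k(2)[OF s] show ?thesis by linarith
  qed
  with k(1) that show ?thesis by blast
qed

lemma tame_evolve:
  assumes L: "admissible L"
  shows "tame (evolve L)"
proof -
  \<comment> \<open>Any positive \<beta> would serve here; for fixed \<beta> the weight and (T -
    s)^(-2\<alpha>) are comparable on [0,T).\<close>
  obtain m where m: "m \<ge> 0" "\<And>s. s \<in> {0..<T} \<Longrightarrow> norm (L s) \<le> m * weight 1 s"
    using admissible_weight_bound[OF L, of 1] by auto
  show ?thesis
  proof (rule tameI[where K = "m * c * \<kappa> 1 * exp T"])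
    fix t x assume t: "t \<in> {0..<T}"
    show "summable (\<lambda>i. \<bar>(adj (C i t) o\<^sub>L evolve L t o\<^sub>L C i t) x \<bullet> x\<bar>)"
      using L m t by (intro evolve_sandwich(1)[where \<beta> = 1]) auto
    have "(\<Sum>i. \<bar>(adj (C i t) o\<^sub>L evolve L t o\<^sub>L C i t) x \<bullet> x\<bar>) \<le> m * c * \<kappa> 1 * weight 1 t * (norm x)\<^sup>2"
      using L m t by (intro evolve_sandwich(2)) auto
    also have "\<dots> \<le> m * c * \<kappa> 1 * (exp (1 * T) * (T - t) powr (- 2 * \<alpha>)) * (norm x)\<^sup>2"
      using t m c \<kappa>_nonneg by (intro mult_right_mono mult_left_mono weight_le) auto
    finally show "(\<Sum>i. \<bar>(adj (C i t) o\<^sub>L evolve L t o\<^sub>L C i t) x \<bullet> x\<bar>)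
        \<le> m * c * \<kappa> 1 * exp T * (T - t) powr (- 2 * \<alpha>) * (norm x)\<^sup>2" by (simp add: mult_ac)
  qed (use evolve_self_adjoint[OF L] evolve_continuous_on[OF L] in blast)+
qed

text \<open>Smoothing at time gap T - t and coefficient time t makes both singular powers equal,
  whence the factor 2.\<close>

lemma tame_terminal:
  assumes G: "self_adjoint G"
  shows "tame (\<lambda>t. adj (S (T - t)) o\<^sub>L G o\<^sub>L S (T - t))"
proof (rule tameI[where K = "2 * norm G * c"])
  show "self_adjoint (adj (S (T - t)) o\<^sub>L G o\<^sub>L S (T - t))" for t
    by (rule self_adjoint_conjugate[OF G])
  show "continuous_on {0..T} (\<lambda>t. (adj (S (T - t)) o\<^sub>L G o\<^sub>L S (T - t)) x)" for x
    unfolding continuous_on_def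
  proof
    fix t assume t: "t \<in> {0..T}"
    have "continuous_on {0..T} (\<lambda>t. S (T - t) x)" "\<And>z. continuous_on {0..T} (\<lambda>t. adj (S (T - t)) z)"
      by (rule continuous_on_compose2[OF S_continuous]
          continuous_on_compose2[OF adj_semigroup_continuous_on[OF S]]; auto intro!: continuous_intros)+
    then have "((\<lambda>t. S (T - t) x) \<longlongrightarrow> S (T - t) x) (at t within {0..T})"
      "((\<lambda>t. adj (S (T - t)) z) \<longlongrightarrow> adj (S (T - t)) z) (at t within {0..T})" for z
      using t unfolding continuous_on_def by blast+
    moreover have "eventually (\<lambda>t. norm (adj (S (T - t))) \<le> M) (at t within {0..T})"
      unfolding eventually_at_filter by (auto intro!: always_eventually norm_adj_S_le)
    ultimately show "((\<lambda>t. (adj (S (T - t)) o\<^sub>L G o\<^sub>L S (T - t)) x)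
        \<longlongrightarrow> (adj (S (T - t)) o\<^sub>L G o\<^sub>L S (T - t)) x) (at t within {0..T})"
      unfolding blinfun_apply_blinfun_compose
      by (rule_tac blinfun_apply_tendsto) (auto intro: bounded_linear.tendsto[OF blinfun.bounded_linear_right])
  qed
  fix t x assume t: "t \<in> {0..<T}"
  define v where "v = (\<lambda>i. norm G * (norm (S (T - t) (C i t x)))\<^sup>2)"
  have le: "\<bar>(adj (C i t) o\<^sub>L (adj (S (T - t)) o\<^sub>L G o\<^sub>L S (T - t)) o\<^sub>L C i t) x \<bullet> x\<bar> \<le> v i" for i
    using abs_quadratic_le[of G "S (T - t) (C i t x)"] by (simp add: adj_inner v_def)
  have sm: "summable v" unfolding v_def using t by (intro summable_mult C_summable) auto
  show sm': "summable (\<lambda>i. \<bar>(adj (C i t) o\<^sub>L (adj (S (T - t)) o\<^sub>L G o\<^sub>L S (T - t)) o\<^sub>L C i t) x \<bullet> x\<bar>)"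
    by (rule summable_comparison_test'[OF sm, of 0]) (use le in simp)
  have "(\<Sum>i. \<bar>(adj (C i t) o\<^sub>L (adj (S (T - t)) o\<^sub>L G o\<^sub>L S (T - t)) o\<^sub>L C i t) x \<bullet> x\<bar>) \<le> (\<Sum>i. v i)"
    by (intro suminf_le le sm sm')
  also have "\<dots> = norm G * (\<Sum>i. (norm (S (T - t) (C i t x)))\<^sup>2)"
    unfolding v_def using t by (intro suminf_mult C_summable) auto
  also have "\<dots> \<le> norm G * (c * ((T - t) powr (- 2 * \<alpha>) + (T - t) powr (- 2 * \<alpha>)) * (norm x)\<^sup>2)"
    using t by (intro mult_left_mono C_bound) auto
  finally show "(\<Sum>i. \<bar>(adj (C i t) o\<^sub>L (adj (S (T - t)) o\<^sub>L G o\<^sub>L S (T - t)) o\<^sub>L C i t) x \<bullet> x\<bar>)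
      \<le> 2 * norm G * c * (T - t) powr (- 2 * \<alpha>) * (norm x)\<^sup>2"
    by (simp add: mult_ac)
qed

text \<open>Since \<kappa> tends to 0, a large \<beta> makes the linear part of the iteration halve
  every weighted bound; \<open>fixed_point_exists\<close> and \<open>fixed_point_unique\<close> both
  apply it to differences.\<close>

lemma contraction:
  obtains \<beta> where "\<beta> > 0" "\<And>L m s. admissible L \<Longrightarrow> m \<ge> 0 \<Longrightarrow>
    (\<And>s. s \<in> {0..<T} \<Longrightarrow> norm (L s) \<le> m * weight \<beta> s) \<Longrightarrow> s \<in> {0..<T} \<Longrightarrow>
    norm (lyap_term A0 C (evolve L) s) \<le> m / 2 * weight \<beta> s"
proof -
  \<comment> \<open>The summand 1 stands for the sum over C, the other for the two \<open>A0\<close>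
    terms, where (T - s)^(-\<alpha>) (T - s)^(2\<alpha>) is at most T^\<alpha>.\<close>
  define q where "q = c * (2 * T powr \<alpha> * M\<^sup>2 + 1)"
  have "((\<lambda>\<beta>. \<kappa> \<beta> * q) \<longlongrightarrow> 0) at_top" by (rule tendsto_mult_left_zero[OF \<kappa>_tendsto])
  then have "eventually (\<lambda>\<beta>. \<kappa> \<beta> * q < 1 / 2) at_top" by (rule order_tendstoD) simp
  with eventually_gt_at_top[of "0 :: real"]
  have "eventually (\<lambda>\<beta>. \<beta> > 0 \<and> \<kappa> \<beta> * q < 1 / 2) at_top" by eventually_elim auto
  then obtain \<beta> where \<beta>: "\<beta> > 0" "\<kappa> \<beta> * q < 1 / 2"
    unfolding eventually_at_top_linorder by blast
  show ?thesis
  proof (rule that[OF \<beta>(1)])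
    fix L m s
    assume L: "admissible L" and m: "m \<ge> 0" and s: "s \<in> {0..<T}"
      and Lm: "\<And>s. s \<in> {0..<T} \<Longrightarrow> norm (L s) \<le> m * weight \<beta> s"
    have w: "weight \<beta> s > 0" using s by (intro weight_pos) auto
    have "norm (lyap_term A0 C (evolve L) s)
        \<le> 2 * c * (T - s) powr (- \<alpha>) * (m * M\<^sup>2 * (T - s) powr (2 * \<alpha>) * \<kappa> \<beta> * weight \<beta> s)
          + m * c * \<kappa> \<beta> * weight \<beta> s"
      using w m c \<kappa>_nonneg
      by (intro norm_lyap_term_le tame_evolve norm_evolve_le evolve_sandwich(2) L Lm \<beta> s) auto
    also have "\<dots> = m * weight \<beta> s * \<kappa> \<beta> * (c * (2 * ((T - s) powr (- \<alpha>) * (T - s) powr (2 * \<alpha>)) * M\<^sup>2 + 1))"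
      by (simp add: algebra_simps)
    also have "(T - s) powr (- \<alpha>) * (T - s) powr (2 * \<alpha>) = (T - s) powr \<alpha>"
      by (simp add: powr_add[symmetric])
    also have "m * weight \<beta> s * \<kappa> \<beta> * (c * (2 * (T - s) powr \<alpha> * M\<^sup>2 + 1)) \<le> m * weight \<beta> s * \<kappa> \<beta> * q"
      unfolding q_def using m w \<kappa>_nonneg c \<alpha> s
      by (intro mult_left_mono add_right_mono mult_right_mono powr_mono2) auto
    also have "\<dots> = m * weight \<beta> s * (\<kappa> \<beta> * q)" by simp
    also have "\<dots> \<le> m * weight \<beta> s * (1 / 2)"
      using m w \<beta>(2) by (intro mult_left_mono) auto
    finally show "norm (lyap_term A0 C (evolve L) s) \<le> m / 2 * weight \<beta> s" by simp
  qed
qed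


section \<open>The fixed point\<close>

lemma lyap_term_cong: "P s = Q s \<Longrightarrow> lyap_term A0 C P s = lyap_term A0 C Q s"
  by (simp add: lyap_term_def)

lemma lyap_term_affine_diff:
  assumes P0: "tame P0" and L: "admissible L" and L': "admissible L'" and s: "s \<in> {0..<T}"
  shows "lyap_term A0 C (\<lambda>t. P0 t + evolve L t) s - lyap_term A0 C (\<lambda>t. P0 t + evolve L' t) s
    = lyap_term A0 C (evolve (\<lambda>s. L s - L' s)) s"
proof -
  have "evolve L s - evolve L' s = evolve (\<lambda>s. L s - L' s) s"
    using s by (intro evolve_diff[symmetric] L L' admissible_diff) auto
  then have "lyap_term A0 C (evolve (\<lambda>s. L s - L' s)) s
      = lyap_term A0 C (\<lambda>t. (P0 t + evolve L t) - (P0 t + evolve L' t)) s"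
    by (intro lyap_term_cong) simp
  also have "\<dots> = lyap_term A0 C (\<lambda>t. P0 t + evolve L t) s
      - lyap_term A0 C (\<lambda>t. P0 t + evolve L' t) s"
    by (intro lyap_term_diff tame_add P0 tame_evolve L L' s)
  finally show ?thesis by simp
qed

text \<open>Picard iteration of F on brackets. At each s < T it converges in operator norm with
  geometric rate relative to the weight, so the limit inherits pointwise measurability,
  self-adjointness and the growth bound.\<close>

lemma fixed_point_exists:
  assumes P0: "tame P0"
  shows "\<exists>P. tame P \<and> (\<forall>t\<in>{0..T}. P t = P0 t + evolve (lyap_term A0 C P) t)"
proof -
  define F where "F = (\<lambda>L. lyap_term A0 C (\<lambda>t. P0 t + evolve L t))"
  have F: "admissible (F L)" if "admissible L" for L
    unfolding F_def by (intro lyap_term_admissible tame_add tame_evolve P0 that)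
  obtain \<beta> where \<beta>: "\<beta> > 0" and contr: "\<And>L m s. admissible L \<Longrightarrow> m \<ge> 0 \<Longrightarrow>
    (\<And>s. s \<in> {0..<T} \<Longrightarrow> norm (L s) \<le> m * weight \<beta> s) \<Longrightarrow> s \<in> {0..<T} \<Longrightarrow>
    norm (lyap_term A0 C (evolve L) s) \<le> m / 2 * weight \<beta> s"
    using contraction by metis
  have step: "norm (F L s - F L' s) \<le> m / 2 * weight \<beta> s"
    if "admissible L" "admissible L'" "m \<ge> 0" "s \<in> {0..<T}"
      "\<And>s. s \<in> {0..<T} \<Longrightarrow> norm (L s - L' s) \<le> m * weight \<beta> s" for L L' m s
    unfolding F_def lyap_term_affine_diff[OF P0 that(1,2,4)]
    using that by (intro contr admissible_diff) auto
  define L where "L = (\<lambda>n. (F ^^ n) (lyap_term A0 C P0))"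
  have LSuc: "L (Suc n) = F (L n)" for n by (simp add: L_def)
  have adm: "admissible (L n)" for n
    by (induction n) (simp_all add: L_def F lyap_term_admissible P0)
  obtain m where m: "m \<ge> 0" "\<And>s. s \<in> {0..<T} \<Longrightarrow> norm (L 1 s - L 0 s) \<le> m * weight \<beta> s"
    using admissible_weight_bound[OF admissible_diff[OF adm[of 1] adm[of 0]] \<beta>] by metis
  have d: "norm (L (Suc n) s - L n s) \<le> m / 2 ^ n * weight \<beta> s" if "s \<in> {0..<T}" for n s
    using that
  proof (induction n arbitrary: s)
    case 0
    then show ?case using m(2) by simp
  next
    case (Suc n)
    have "norm (F (L (Suc n)) s - F (L n) s) \<le> (m / 2 ^ n) / 2 * weight \<beta> s"
      using Suc m by (intro step adm) auto
    then show ?case by (simp add: LSuc mult.commute)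
  qed
  have dd: "norm (L (n + j) s - L n s) \<le> m * weight \<beta> s * (2 / 2 ^ n)" if s: "s \<in> {0..<T}" for n j s
  proof -
    \<comment> \<open>The exact geometric partial sum, so that the induction on j closes; the
      subtracted term is dropped afterwards.\<close>
    have "norm (L (n + j) s - L n s) \<le> m * weight \<beta> s * (2 / 2 ^ n - 2 / 2 ^ (n + j))"
    proof (induction j)
      case (Suc j)
      have "norm (L (n + Suc j) s - L n s)
          \<le> norm (L (Suc (n + j)) s - L (n + j) s) + norm (L (n + j) s - L n s)"
        using norm_triangle_ineq[of "L (Suc (n + j)) s - L (n + j) s" "L (n + j) s - L n s"] by simp
      also have "\<dots> \<le> m / 2 ^ (n + j) * weight \<beta> s
          + m * weight \<beta> s * (2 / 2 ^ n - 2 / 2 ^ (n + j))"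
        by (intro add_mono d s Suc)
      also have "\<dots> = m * weight \<beta> s * (2 / 2 ^ n - 2 / 2 ^ (n + Suc j))"
        by (simp add: field_simps)
      finally show ?case .
    qed simp
    also have "\<dots> \<le> m * weight \<beta> s * (2 / 2 ^ n)"
      using m(1) weight_pos[of s \<beta>] s by (intro mult_left_mono) auto
    finally show ?thesis .
  qed
  have "\<exists>K. (\<lambda>n. L n s) \<longlonglongrightarrow> K" if s: "s \<in> {0..<T}" for s
  proof -
    have "summable (\<lambda>n. m * weight \<beta> s * (1 / 2) ^ n)"
      by (intro summable_mult summable_geometric) simp
    then have "summable (\<lambda>n. L (Suc n) s - L n s)"
      by (rule summable_comparison_test'[where N = 0]) (use d[OF s] in \<open>simp add: power_divide\<close>)
    then have "(\<lambda>n. \<Sum>i<n. L (Suc i) s - L i s) \<longlonglongrightarrow> (\<Sum>n. L (Suc n) s - L n s)"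
      by (rule summable_LIMSEQ)
    from tendsto_add[OF this tendsto_const[of "L 0 s"]] show ?thesis
      unfolding sum_lessThan_telescope[of "\<lambda>n. L n s"] by auto
  qed
  then obtain K where K: "\<And>s. s \<in> {0..<T} \<Longrightarrow> (\<lambda>n. L n s) \<longlonglongrightarrow> K s" by metis
  have KL: "norm (K s - L n s) \<le> (m * (2 / 2 ^ n)) * weight \<beta> s" if s: "s \<in> {0..<T}" for n s
  proof (rule LIMSEQ_le_const2)
    show "(\<lambda>p. norm (L p s - L n s)) \<longlonglongrightarrow> norm (K s - L n s)" by (intro tendsto_intros K s)
    have "norm (L p s - L n s) \<le> (m * (2 / 2 ^ n)) * weight \<beta> s" if "p \<ge> n" for p
      using dd[OF s, of n "p - n"] that by (simp add: mult_ac)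
    then show "\<exists>N. \<forall>p\<ge>N. norm (L p s - L n s) \<le> (m * (2 / 2 ^ n)) * weight \<beta> s" by blast
  qed
  have Kadm: "admissible K"
    unfolding admissible_def
  proof (intro conjI allI)
    fix x
    show "(\<lambda>s. K s x) \<in> borel_measurable (lebesgue_on {0<..<T})"
    proof (rule borel_measurable_LIMSEQ_metric)
      show "(\<lambda>s. L n s x) \<in> borel_measurable (lebesgue_on {0<..<T})" for n
        using adm[of n] by (simp add: admissible_def)
      show "(\<lambda>n. L n s x) \<longlonglongrightarrow> K s x" if "s \<in> space (lebesgue_on {0<..<T})" for s
        using that by (intro tendsto_intros K) auto
    qed
  next
    have "AE s in lebesgue_on {0<..<T}. \<forall>n. self_adjoint (L n s)"
      using adm by (simp add: admissible_def AE_all_countable)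
    moreover have "AE s in lebesgue_on {0<..<T}. s \<in> {0<..<T}" by (rule AE_I2) simp
    ultimately show "AE s in lebesgue_on {0<..<T}. self_adjoint (K s)"
    proof eventually_elim
      case (elim s)
      show ?case
        unfolding self_adjoint_def
      proof (intro allI)
        fix x y
        have s: "s \<in> {0..<T}" using elim by auto
        have "(\<lambda>n. L n s x \<bullet> y) \<longlonglongrightarrow> K s x \<bullet> y" by (intro tendsto_intros K s)
        moreover have "(\<lambda>n. L n s x \<bullet> y) \<longlonglongrightarrow> x \<bullet> K s y"
          using elim unfolding self_adjoint_def by (simp add: tendsto_inner K s blinfun.tendsto)
        ultimately show "K s x \<bullet> y = x \<bullet> K s y" by (rule LIMSEQ_unique)
      qed
    qed
  next
    obtain k where k: "k \<ge> 0" "\<And>s. s \<in> {0..<T} \<Longrightarrow> norm (L 0 s) \<le> k * (T - s) powr (- 2 * \<alpha>)"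
      using adm[of 0] unfolding admissible_def by blast
    show "\<exists>k\<ge>0. \<forall>s\<in>{0..<T}. norm (K s) \<le> k * (T - s) powr (- 2 * \<alpha>)"
    proof (intro exI[of _ "m * 2 * exp (\<beta> * T) + k"] conjI ballI)
      fix s assume s: "s \<in> {0..<T}"
      have "norm (K s) \<le> norm (K s - L 0 s) + norm (L 0 s)" by (metis diff_add_cancel norm_triangle_ineq)
      also have "\<dots> \<le> (m * 2) * weight \<beta> s + k * (T - s) powr (- 2 * \<alpha>)"
        using KL[OF s, of 0] k(2)[OF s] by simp
      also have "\<dots> \<le> (m * 2) * (exp (\<beta> * T) * (T - s) powr (- 2 * \<alpha>)) + k * (T - s) powr (- 2 * \<alpha>)"
        using m \<beta> s by (intro add_right_mono mult_left_mono weight_le) auto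
      finally show "norm (K s) \<le> (m * 2 * exp (\<beta> * T) + k) * (T - s) powr (- 2 * \<alpha>)"
        by (simp add: algebra_simps)
    qed (use m k in simp)
  qed
  \<comment> \<open>K and F K are both limits of \<open>L (Suc n)\<close>, the latter by one more
    contraction step applied to \<open>KL\<close>.\<close>
  have fix_K: "F K s = K s" if s: "s \<in> {0..<T}" for s
  proof (rule LIMSEQ_unique)
    show "(\<lambda>n. L (Suc n) s) \<longlonglongrightarrow> K s" by (rule LIMSEQ_Suc[OF K[OF s]])
    have "(\<lambda>n. L (Suc n) s - F K s) \<longlonglongrightarrow> 0"
    proof (rule Lim_null_comparison)
      have "norm (L (Suc n) s - F K s) \<le> (m * (2 / 2 ^ n)) / 2 * weight \<beta> s" for n
        unfolding LSuc using m s by (subst norm_minus_commute) (intro step Kadm adm KL, auto)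
      then show "eventually (\<lambda>n. norm (L (Suc n) s - F K s) \<le> m * weight \<beta> s * (1 / 2) ^ n) sequentially"
        by (intro always_eventually) (simp add: power_divide mult_ac)
      show "(\<lambda>n. m * weight \<beta> s * (1 / 2) ^ n) \<longlonglongrightarrow> 0"
        by (intro tendsto_mult_right_zero LIMSEQ_power_zero) simp
    qed
    then show "(\<lambda>n. L (Suc n) s) \<longlonglongrightarrow> F K s" by (simp add: LIM_zero_cancel)
  qed
  define P where "P = (\<lambda>t. P0 t + evolve K t)"
  have "tame P" unfolding P_def by (intro tame_add tame_evolve P0 Kadm)
  moreover have "P t = P0 t + evolve (lyap_term A0 C P) t" if t: "t \<in> {0..T}" for t
  proof -
    \<comment> \<open>The bracket of P is known to equal K only for s < T, which is enough under the
      integral.\<close>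
    have "evolve (lyap_term A0 C P) t = evolve K t"
      using fix_K by (intro evolve_cong lyap_term_admissible Kadm t \<open>tame P\<close>) (simp add: F_def P_def)
    then show ?thesis by (simp add: P_def)
  qed
  ultimately show ?thesis by blast
qed

text \<open>The difference L of the two brackets equals the bracket of \<open>evolve L\<close>, so
  each bound on it can be halved again; admissibility supplies the first finite bound. Hence L = 0
  for s < T, and the equation gives P = Q up to and including T.\<close>

lemma fixed_point_unique:
  assumes P: "tame P" "\<And>t. t \<in> {0..T} \<Longrightarrow> P t = P0 t + evolve (lyap_term A0 C P) t"
    and Q: "tame Q" "\<And>t. t \<in> {0..T} \<Longrightarrow> Q t = P0 t + evolve (lyap_term A0 C Q) t"
    and t: "t \<in> {0..T}"
  shows "Q t = P t"
proof -
  obtain \<beta> where \<beta>: "\<beta> > 0" and contr: "\<And>L m s. admissible L \<Longrightarrow> m \<ge> 0 \<Longrightarrow>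
    (\<And>s. s \<in> {0..<T} \<Longrightarrow> norm (L s) \<le> m * weight \<beta> s) \<Longrightarrow> s \<in> {0..<T} \<Longrightarrow>
    norm (lyap_term A0 C (evolve L) s) \<le> m / 2 * weight \<beta> s"
    using contraction by metis
  define L where "L = (\<lambda>s. lyap_term A0 C P s - lyap_term A0 C Q s)"
  have aP: "admissible (lyap_term A0 C P)" and aQ: "admissible (lyap_term A0 C Q)"
    by (intro lyap_term_admissible P Q)+
  have aL: "admissible L" unfolding L_def by (intro admissible_diff aP aQ)
  have ev: "evolve L s = P s - Q s" if "s \<in> {0..T}" for s
    using evolve_diff[OF aP aQ aL[unfolded L_def] that] P(2)[OF that] Q(2)[OF that]
    by (simp add: L_def)
  have L: "lyap_term A0 C (evolve L) s = L s" if s: "s \<in> {0..<T}" for s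
  proof -
    have "lyap_term A0 C (evolve L) s = lyap_term A0 C (\<lambda>t. P t - Q t) s"
      using s by (intro lyap_term_cong ev) auto
    then show ?thesis unfolding L_def lyap_term_diff[OF P(1) Q(1) s] .
  qed
  obtain m where m: "m \<ge> 0" "\<And>s. s \<in> {0..<T} \<Longrightarrow> norm (L s) \<le> m * weight \<beta> s"
    using admissible_weight_bound[OF aL \<beta>] by metis
  have d: "norm (L s) \<le> m / 2 ^ n * weight \<beta> s" if "s \<in> {0..<T}" for n s
    using that
  proof (induction n arbitrary: s)
    case 0
    then show ?case using m(2) by simp
  next
    case (Suc n)
    have "norm (lyap_term A0 C (evolve L) s) \<le> (m / 2 ^ n) / 2 * weight \<beta> s"
      using Suc m by (intro contr aL) auto
    then show ?case by (simp add: L[OF Suc.prems] mult.commute)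
  qed
  have L0: "L s = 0" if s: "s \<in> {0..<T}" for s
  proof -
    have "(\<lambda>n. m * weight \<beta> s * (1 / 2) ^ n) \<longlonglongrightarrow> 0"
      by (intro tendsto_mult_right_zero LIMSEQ_power_zero) simp
    then have "norm (L s) \<le> 0"
      using d[OF s] by (intro LIMSEQ_le_const[of _ 0]) (auto simp: power_divide)
    then show ?thesis by simp
  qed
  have "evolve (lyap_term A0 C P) t = evolve (lyap_term A0 C Q) t"
    using L0 by (intro evolve_cong aP aQ t) (simp add: L_def)
  then show ?thesis using P(2)[OF t] Q(2)[OF t] by simp
qed

text \<open>For a tame P the integrability and summability clauses hold automatically, and the
  identities for all x combine into one between operators.\<close>

lemma mild_solution_iff:
  assumes P: "tame P" and f: "admissible f"
  shows "mild_solution T S A0 C f G P \<longleftrightarrow>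
    (\<forall>t\<in>{0..T}. P t = ((adj (S (T - t)) o\<^sub>L G o\<^sub>L S (T - t)) + evolve f t)
                     + evolve (lyap_term A0 C P) t)"
proof -
  note aP = lyap_term_admissible[OF P]
  have Cs: "P \<in> Cs_self_adjoint T" using P by (simp add: tame_def)
  define E where "E = (\<lambda>t x. P t x = (adj (S (T - t)) o\<^sub>L G o\<^sub>L S (T - t)) x
          + (\<integral>s. (adj (S (s - t)) o\<^sub>L f s o\<^sub>L S (s - t)) x \<partial>lebesgue_on {t..T})
          + (\<integral>s. (adj (S (s - t)) o\<^sub>L lyap_term A0 C P s o\<^sub>L S (s - t)) x \<partial>lebesgue_on {t..T}))"
  have eq: "(\<forall>x. E t x) \<longleftrightarrow>
      P t = ((adj (S (T - t)) o\<^sub>L G o\<^sub>L S (T - t)) + evolve f t) + evolve (lyap_term A0 C P) t"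
    if t: "t \<in> {0..T}" for t
    unfolding E_def evolve_apply[OF f t, symmetric] evolve_apply[OF aP t, symmetric]
      blinfun.add_left[symmetric]
    by (auto intro: blinfun_eqI)
  define I where "I = (\<lambda>h t x. integrable (lebesgue_on {t..T})
      (\<lambda>s. (adj (S (s - t)) o\<^sub>L h s o\<^sub>L S (s - t)) x))"
  have I: "\<forall>t\<in>{0..T}. \<forall>x. I f t x \<and> I (lyap_term A0 C P) t x"
    unfolding I_def by (intro ballI allI conjI conjugate_integrable f aP)
  have sm: "\<forall>s\<in>{0..<T}. \<forall>x. summable (\<lambda>i. \<bar>(adj (C i s) o\<^sub>L P s o\<^sub>L C i s) x \<bullet> x\<bar>)"
    by (intro ballI allI tameD(3)[OF P])
  have "mild_solution T S A0 C f G P \<longleftrightarrow>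
      (\<forall>t\<in>{0..T}. \<forall>x. I f t x \<and> I (lyap_term A0 C P) t x \<and> E t x)"
    unfolding mild_solution_def I_def E_def
    by (rule iffI, elim conjE, assumption, intro conjI Cs sm, assumption)
  also have "\<dots> \<longleftrightarrow> (\<forall>t\<in>{0..T}. \<forall>x. E t x)" using I by blast
  finally show ?thesis using eq by simp
qed

end

theorem theorem3p4:
  fixes T c \<alpha> :: real
    and D :: "'h::{real_inner,banach,second_countable_topology} set"
    and A :: "'h \<Rightarrow> 'h"
    and S :: "real \<Rightarrow> 'h \<Rightarrow>\<^sub>L 'h"
    and G :: "'h \<Rightarrow>\<^sub>L 'h"
    and f A0 :: "real \<Rightarrow> 'h \<Rightarrow>\<^sub>L 'h"
    and C :: "nat \<Rightarrow> real \<Rightarrow> 'h \<Rightarrow>\<^sub>L 'h"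
  assumes "T > 0" and "c > 0" and "0 < \<alpha>" and "\<alpha> < 1 / 2"
    and "infinitesimal_generator D A S"
    and "self_adjoint G"
    and "f \<in> bochner_L1 T" and "AE s in lebesgue_on {0<..<T}. self_adjoint (f s)"
    and "\<forall>s\<in>{0..<T}. norm (f s) \<le> c * (T - s) powr (- 2 * \<alpha>)"
    and "A0 \<in> bochner_Linf T" and "\<forall>j. C j \<in> bochner_Linf T"
    and "\<forall>s\<in>{0..<T}. norm (A0 s) \<le> c * (T - s) powr (- \<alpha>)"
    and "\<forall>t>0. \<forall>s\<in>{0..<T}. \<forall>x.
           summable (\<lambda>j. (norm (S t (C j s x)))\<^sup>2) \<and>
           (\<Sum>j. (norm (S t (C j s x)))\<^sup>2)
             \<le> c * (t powr (- 2 * \<alpha>) + (T - s) powr (- 2 * \<alpha>)) * (norm x)\<^sup>2"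
  shows "\<exists>P. mild_solution T S A0 C f G P \<and>
             (\<exists>K>0. sandwich_estimate T \<alpha> C P K) \<and>
             (\<forall>Q. mild_solution T S A0 C f G Q \<and> (\<exists>K>0. sandwich_estimate T \<alpha> C Q K)
                  \<longrightarrow> (\<forall>t\<in>{0..T}. Q t = P t))"
proof -
  have S: "c0_semigroup S" using assms(5) by (simp add: infinitesimal_generator_def)
  obtain M where M: "M > 0" "\<forall>t\<in>{0..T}. norm (S t) \<le> M" using c0_semigroup_bounded[OF S] by blast
  interpret lyapunov T c \<alpha> M S A0 C
  proof
    show "(\<lambda>s. A0 s x) \<in> borel_measurable (lebesgue_on {0<..<T})"
      "(\<lambda>s. C j s x) \<in> borel_measurable (lebesgue_on {0<..<T})" for j x
      using assms(10,11) by (auto simp: bochner_Linf_def intro: bochner_measurable_apply)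
  qed (use assms S M in auto)
  have f: "admissible f"
    unfolding admissible_def
    using assms(2,7,8,9) by (auto simp: bochner_L1_def intro!: bochner_measurable_apply exI[of _ c])
  \<comment> \<open>\<open>f\<close> is itself admissible, so its integral is an instance of
    \<open>evolve\<close>; \<open>G\<close> and \<open>f\<close> merge into one tame
    inhomogeneity.\<close>
  define P0 where "P0 = (\<lambda>t. (adj (S (T - t)) o\<^sub>L G o\<^sub>L S (T - t)) + evolve f t)"
  have P0: "tame P0" unfolding P0_def by (intro tame_add tame_terminal tame_evolve assms f)
  have iff: "mild_solution T S A0 C f G P \<longleftrightarrow> (\<forall>t\<in>{0..T}. P t = P0 t + evolve (lyap_term A0 C P) t)"
    if "tame P" for P
    unfolding P0_def by (rule mild_solution_iff[OF that f])
  have tame: "tame Q" if "mild_solution T S A0 C f G Q" "\<exists>K>0. sandwich_estimate T \<alpha> C Q K" for Q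
    using that by (simp add: tame_def mild_solution_def)
  obtain P where P: "tame P" "\<forall>t\<in>{0..T}. P t = P0 t + evolve (lyap_term A0 C P) t"
    using fixed_point_exists[OF P0] by blast
  show ?thesis
  proof (intro exI[of _ P] conjI allI impI ballI)
    show "mild_solution T S A0 C f G P" using P by (simp add: iff)
    show "\<exists>K>0. sandwich_estimate T \<alpha> C P K" using P(1) by (simp add: tame_def)
    fix Q t
    assume Q: "mild_solution T S A0 C f G Q \<and> (\<exists>K>0. sandwich_estimate T \<alpha> C Q K)" and t: "t \<in> {0..T}"
    then have "tame Q" by (intro tame) auto
    with P Q show "Q t = P t" using iff[of Q] by (intro fixed_point_unique[of P P0 Q t] t) auto
  qed
qed

end
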